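(* Let $\mathcal P=(X,\prec)$ be a poset on $|X|=n$ elements, and let $\omega:X\to\mathbb R_{>0}$ be a positive order-reversing weight function, i.e. $x\preccurlyeq y$ implies $\omega(x)\ge\omega(y)$. Fix an element $z\in X$ and an integer $1<k<n$, and suppose that $\mathrm N_\omega(k)>0$. Then the following are equivalent: (a) $\mathrm N_\omega(k)^2=\mathrm N_\omega(k-1)\cdot\mathrm N_\omega(k+1)$; (b) there exists $s>0$ such that $\mathrm N_\omega(k+1)=s\,\mathrm N_\omega(k)=s^2\,\mathrm N_\omega(k-1)$; (c) there exists $s>0$ such that $f(x)>k$ for all $x\succ z$, $g(x)>n-k+1$ for all $x\prec z$, and $$\omega\bigl(L^{-1}(k-1)\bigr)=\omega\bigl(L^{-1}(k+1)\bigr)=s\qquad\text{for all }L\in\mathcal E_k .$$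
   Context: A linear extension of $\mathcal P$ is a bijection $L:X\to\{1,\dots,n\}$ with $L(x)<L(y)$ whenever $x\prec y$. Let $\mathcal E_k$ be the set of linear extensions $L$ with $L(z)=k$. For a linear extension $L$ put $\omega(L)=\prod_{x:\,L(x)<L(z)}\omega(x)$, and $\mathrm N_\omega(k)=\sum_{L\in\mathcal E_k}\omega(L)$ for $1\le k\le n$. For $x\in X$: $f(x)=|\{y\in X:y\prec x\}|$ and $g(x)=|\{y\in X:y\succ x\}|$. *)

theory Defs
  imports Complex_Main "HOL-Library.FuncSet"
begin

text \<open>
  A finite poset is given by a carrier \<open>X\<close> and its weak order \<open>r\<close>, with
  \<^prop>\<open>partial_order_on X r\<close>; the strict order is derived from it.
\<close>

definition prec :: "'a rel \<Rightarrow> 'a \<Rightarrow> 'a \<Rightarrow> bool" where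
  "prec r x y \<longleftrightarrow> (x, y) \<in> r \<and> x \<noteq> y"

text \<open>
  Membership in \<^term>\<open>extensional X\<close> makes a linear extension determined by its values
  on \<open>X\<close>, so that distinct elements of this set are distinct bijections and the set is finite.
\<close>

definition linear_extensions :: "'a set \<Rightarrow> 'a rel \<Rightarrow> ('a \<Rightarrow> nat) set" where
  "linear_extensions X r =
     {L \<in> extensional X. bij_betw L X {1..card X} \<and>
        (\<forall>x\<in>X. \<forall>y\<in>X. prec r x y \<longrightarrow> L x < L y)}"

definition linear_extensions_at :: "'a set \<Rightarrow> 'a rel \<Rightarrow> 'a \<Rightarrow> nat \<Rightarrow> ('a \<Rightarrow> nat) set" where
  "linear_extensions_at X r z k = {L \<in> linear_extensions X r. L z = k}"

definition ext_weight :: "'a set \<Rightarrow> ('a \<Rightarrow> real) \<Rightarrow> 'a \<Rightarrow> ('a \<Rightarrow> nat) \<Rightarrow> real" where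
  "ext_weight X \<omega> z L = (\<Prod>x\<in>{x \<in> X. L x < L z}. \<omega> x)"

definition N_weighted :: "'a set \<Rightarrow> 'a rel \<Rightarrow> ('a \<Rightarrow> real) \<Rightarrow> 'a \<Rightarrow> nat \<Rightarrow> real" where
  "N_weighted X r \<omega> z k = (\<Sum>L\<in>linear_extensions_at X r z k. ext_weight X \<omega> z L)"

definition num_below :: "'a set \<Rightarrow> 'a rel \<Rightarrow> 'a \<Rightarrow> nat" where
  "num_below X r x = card {y \<in> X. prec r y x}"

definition num_above :: "'a set \<Rightarrow> 'a rel \<Rightarrow> 'a \<Rightarrow> nat" where
  "num_above X r x = card {y \<in> X. prec r x y}"

end

theory Submission
  imports Defs "HOL-Analysis.Function_Topology"
begin

text \<open>
  The proof uses the combinatorial atlas of Chan and Pak.  For a set \<open>R\<close> containing \<open>z\<close>, the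
  numbers \<open>N(k+1), N(k), N(k-1)\<close> are the values \<open>\<langle>p, M p\<rangle>, \<langle>p, M q\<rangle>, \<langle>q, M q\<rangle>\<close> of one
  symmetric matrix \<open>M\<close>, whose rows are the minimal elements of \<open>R\<close> (where \<open>p\<close> is 1) and its
  maximal elements (where \<open>q\<close> is 1), and whose entries count the extensions of what remains
  after two removals.  The form of \<open>M\<close> is hyperbolic: a row of \<open>M\<close> is a value of the form of the
  smaller set with that element removed, so hyperbolicity passes from the smaller sets to \<open>R\<close>.
  The order-reversing hypothesis on the weight enters only for sets of three elements.

  In the equality case a vector \<open>p - s q\<close> lies in the kernel of \<open>M\<close>.  This passes to the smaller
  sets met while a given extension is peeled from both ends, down to \<open>z\<close> and its two neighbours,
  where it says that both neighbours have weight \<open>s\<close> and are incomparable to \<open>z\<close>.  If some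
  \<open>x\<close> above \<open>z\<close> had \<open>f(x) \<le> k\<close>, a minimal such \<open>x\<close> could be placed immediately after \<open>z\<close>.
  Conversely, when neighbours of \<open>z\<close> are incomparable to it, exchanging them with \<open>z\<close> gives (b).
\<close>

section \<open>Hyperbolic bilinear forms\<close>

text \<open>Against p the smaller form produces a row of one matrix of \<open>R\<close>, against q a
  row of the matrix with the middle position lowered by one. Neither p nor q is positive, while the
  spectral argument, in the style of Perron and Frobenius, needs a positive vector h and a connected
  matrix. So the induction runs over mixtures of two consecutive matrices with positive coefficients
  \<alpha>, \<beta>, whose rows are values against h = \<alpha> p + \<beta> q. Together with
  \<open>pull\<close>, the inequality B(v,v) B(h,h) \<le> B(v,h)^2 for the smaller forms bounds the
  form of the mixture by the squared norm of its own operator. Single matrices are limits as one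
  coefficient tends to 0. The equality case allows no such limit, as the kernel vector belongs to
  one matrix. There one coefficient is 0, h is p or q, and information passes only through removals
  on the matching side. Where a smaller form vanishes at h, hyperbolicity says nothing; that the
  other counts vanish too then follows from the criterion for an extension to exist, namely enough
  room below and above \<open>z\<close>.\<close>

definition bform :: "'i set \<Rightarrow> ('i \<Rightarrow> 'i \<Rightarrow> real) \<Rightarrow> ('i \<Rightarrow> real) \<Rightarrow> ('i \<Rightarrow> real) \<Rightarrow> real" where
  "bform I M u v = (\<Sum>i\<in>I. u i * (\<Sum>j\<in>I. M i j * v j))"

definition hyperbolic :: "'i set \<Rightarrow> ('i \<Rightarrow> 'i \<Rightarrow> real) \<Rightarrow> bool" where
  "hyperbolic I M \<longleftrightarrow>
    (\<forall>u v. bform I M v v > 0 \<longrightarrow> bform I M u u * bform I M v v \<le> (bform I M u v)\<^sup>2)"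

lemma bform_cong:
  assumes "\<And>i. i \<in> I \<Longrightarrow> u i = u' i" "\<And>i. i \<in> I \<Longrightarrow> v i = v' i"
  shows "bform I M u v = bform I M u' v'"
  unfolding bform_def using assms by (intro sum.cong) auto

lemma bform_add_left: "bform I M (\<lambda>i. u i + u' i) v = bform I M u v + bform I M u' v"
  by (simp add: bform_def algebra_simps sum.distrib)

lemma bform_add_right: "bform I M u (\<lambda>i. v i + v' i) = bform I M u v + bform I M u v'"
  by (simp add: bform_def algebra_simps sum.distrib)

lemma bform_scale_left: "bform I M (\<lambda>i. c * u i) v = c * bform I M u v"
  by (simp add: bform_def algebra_simps sum_distrib_left)

lemma bform_scale_right: "bform I M u (\<lambda>i. c * v i) = c * bform I M u v"
  by (simp add: bform_def algebra_simps sum_distrib_left)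

lemmas bform_linear = bform_add_left bform_add_right bform_scale_left bform_scale_right

lemma bform_sym:
  assumes "\<forall>i\<in>I. \<forall>j\<in>I. M i j = M j i"
  shows "bform I M u v = bform I M v u"
proof -
  have "bform I M u v = (\<Sum>i\<in>I. \<Sum>j\<in>I. u i * (M i j * v j))"
    by (simp add: bform_def sum_distrib_left)
  also have "\<dots> = (\<Sum>j\<in>I. \<Sum>i\<in>I. u i * (M i j * v j))"
    by (rule sum.swap)
  also have "\<dots> = (\<Sum>j\<in>I. \<Sum>i\<in>I. v j * (M j i * u i))"
    using assms by (intro sum.cong) auto
  also have "\<dots> = bform I M v u"
    by (simp add: bform_def sum_distrib_left)
  finally show ?thesis .
qed

lemma bform_point:
  assumes "finite I" "i \<in> I"
  shows "bform I M (\<lambda>j. if j = i then 1 else 0) v = (\<Sum>j\<in>I. M i j * v j)"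
  using assms by (simp add: bform_def if_distrib[of "\<lambda>x. x * _"] cong: if_cong)

lemma bform_add_mult:
  assumes "\<forall>i\<in>I. \<forall>j\<in>I. M i j = M j i"
  shows "bform I M (\<lambda>i. u i + t * v i) (\<lambda>i. u i + t * v i) =
    bform I M u u + 2 * t * bform I M u v + t\<^sup>2 * bform I M v v"
  by (simp add: bform_linear bform_sym[OF assms, where u = v and v = u] algebra_simps power2_eq_square)

text \<open>Near \<open>t = 0\<close> the linear term would dominate. This is the first-order
  condition at a maximum, used once for the maximizer of a Rayleigh quotient and once for a null
  vector of a form that is nonpositive on a subspace.\<close>

lemma linear_term_zero:
  fixes b c :: real
  assumes "\<And>t. 2 * t * b + t\<^sup>2 * c \<le> 0"
  shows "b = 0"
proof (rule ccontr)
  assume "b \<noteq> 0"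
  define d where "d = \<bar>c\<bar> + 1"
  define t where "t = b / d"
  have "d > 0" by (simp add: d_def add_nonneg_pos)
  then have b: "b = t * d" by (simp add: t_def)
  with \<open>b \<noteq> 0\<close> have "t\<^sup>2 > 0" by auto
  moreover have "2 * d + c > 0" using abs_ge_minus_self[of c] abs_ge_zero[of c] unfolding d_def by argo
  ultimately have "t\<^sup>2 * (2 * d + c) > 0" by (rule mult_pos_pos)
  moreover have "t\<^sup>2 * (2 * d + c) = 2 * t * b + t\<^sup>2 * c"
    by (simp add: b power2_eq_square algebra_simps)
  ultimately show False using assms[of t] by linarith
qed

lemma hyperbolicI_orthogonal:
  assumes sym: "\<forall>i\<in>I. \<forall>j\<in>I. M i j = M j i"
    and neg: "\<And>v. bform I M v h = 0 \<Longrightarrow> bform I M v v \<le> 0"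
  shows "hyperbolic I M"
  unfolding hyperbolic_def
proof (intro allI impI)
  fix u v assume pos: "bform I M v v > 0"
  have nz: "bform I M v h \<noteq> 0" using neg[of v] pos by auto
  \<comment> \<open>Moves \<open>u\<close> along \<open>v\<close> into the complement of
    \<open>h\<close>. The nonpositive value there, multiplied by the positive value at
    \<open>v\<close>, completes to a square.\<close>
  define c where "c = - (bform I M u h / bform I M v h)"
  have "bform I M (\<lambda>i. u i + c * v i) h = 0"
    using nz unfolding bform_linear c_def by simp
  from neg[OF this] have le: "bform I M u u + 2 * c * bform I M u v + c\<^sup>2 * bform I M v v \<le> 0"
    by (simp add: bform_add_mult[OF sym])
  have "0 \<le> (bform I M u v + c * bform I M v v)\<^sup>2" by simp
  also have "\<dots> = (bform I M u v)\<^sup>2 - bform I M u u * bform I M v v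
      + bform I M v v * (bform I M u u + 2 * c * bform I M u v + c\<^sup>2 * bform I M v v)"
    by (simp add: power2_eq_square algebra_simps)
  also have "\<dots> \<le> (bform I M u v)\<^sup>2 - bform I M u u * bform I M v v"
    using mult_nonneg_nonpos[OF less_imp_le[OF pos] le] by linarith
  finally show "bform I M u u * bform I M v v \<le> (bform I M u v)\<^sup>2" by simp
qed

lemma hyperbolic_nonpos:
  assumes "hyperbolic I M" "bform I M h h > 0" "bform I M v h = 0"
  shows "bform I M v v \<le> 0"
  using assms unfolding hyperbolic_def
  by (metis mult_le_0_iff not_less power_zero_numeral zero_less_mult_iff less_le_not_le linorder_le_cases)

text \<open>On the complement of \<open>h\<close> the form is negative semidefinite, and a null
  vector of a semidefinite form is orthogonal to everything; \<open>h\<close> itself supplies the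
  one missing direction.\<close>

lemma hyperbolic_kernel:
  assumes hyp: "hyperbolic I M" and sym: "\<forall>i\<in>I. \<forall>j\<in>I. M i j = M j i"
    and pos: "bform I M h h > 0" and orth: "bform I M v h = 0" and null: "bform I M v v = 0"
  shows "bform I M v u = 0"
proof -
  define c where "c = - (bform I M u h / bform I M h h)"
  define u' where "u' = (\<lambda>i. u i + c * h i)"
  have u': "bform I M u' h = 0" using pos unfolding u'_def bform_linear c_def by simp
  have "2 * t * bform I M v u' + t\<^sup>2 * bform I M u' u' \<le> 0" for t
  proof -
    have "bform I M (\<lambda>i. v i + t * u' i) h = 0" by (simp add: bform_linear orth u')
    from hyperbolic_nonpos[OF hyp pos this] show ?thesis
      by (simp add: bform_add_mult[OF sym] null)
  qed
  then have "bform I M v u' = 0" by (rule linear_term_zero)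
  then show ?thesis by (simp add: u'_def bform_linear orth)
qed

section \<open>Perron-Frobenius theory for nonnegative symmetric matrices\<close>

lemma laplacian_identity:
  assumes fin: "finite I" and sym: "\<forall>i\<in>I. \<forall>j\<in>I. M i j = M j i"
    and h: "\<And>i. i \<in> I \<Longrightarrow> h i > 0"
  shows "(\<Sum>i\<in>I. \<Sum>j\<in>I. M i j * h i * h j * (v i / h i - v j / h j)\<^sup>2) =
    2 * ((\<Sum>i\<in>I. (\<Sum>j\<in>I. M i j * h j) * (v i)\<^sup>2 / h i) - bform I M v v)"
proof -
  have "(\<Sum>i\<in>I. \<Sum>j\<in>I. M i j * h i * h j * (v i / h i - v j / h j)\<^sup>2) =
    (\<Sum>i\<in>I. \<Sum>j\<in>I. M i j * h j * (v i)\<^sup>2 / h i + M j i * h i * (v j)\<^sup>2 / h j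
        - 2 * (v i * (M i j * v j)))"
  proof (intro sum.cong refl)
    fix i j assume "i \<in> I" "j \<in> I"
    then have "h i > 0" "h j > 0" "M j i = M i j" using h sym by auto
    then show "M i j * h i * h j * (v i / h i - v j / h j)\<^sup>2 =
        M i j * h j * (v i)\<^sup>2 / h i + M j i * h i * (v j)\<^sup>2 / h j - 2 * (v i * (M i j * v j))"
      by (simp add: field_simps power2_eq_square)
  qed
  also have "\<dots> = (\<Sum>i\<in>I. \<Sum>j\<in>I. M i j * h j * (v i)\<^sup>2 / h i)
      + (\<Sum>i\<in>I. \<Sum>j\<in>I. M j i * h i * (v j)\<^sup>2 / h j)
      - 2 * (\<Sum>i\<in>I. \<Sum>j\<in>I. v i * (M i j * v j))"
    by (simp add: sum.distrib sum_subtractf sum_distrib_left)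
  also have "(\<Sum>i\<in>I. \<Sum>j\<in>I. M j i * h i * (v j)\<^sup>2 / h j) =
      (\<Sum>i\<in>I. \<Sum>j\<in>I. M i j * h j * (v i)\<^sup>2 / h i)"
    by (rule sum.swap)
  also have "(\<Sum>i\<in>I. \<Sum>j\<in>I. M i j * h j * (v i)\<^sup>2 / h i) =
      (\<Sum>i\<in>I. (\<Sum>j\<in>I. M i j * h j) * (v i)\<^sup>2 / h i)"
    by (simp add: sum_distrib_right sum_divide_distrib)
  finally show ?thesis by (simp add: bform_def sum_distrib_left)
qed

lemma quadratic_maximizer:
  fixes I :: "'i set" and m :: "'i \<Rightarrow> real"
  assumes fin: "finite I" and m: "\<And>i. i \<in> I \<Longrightarrow> m i > 0"
    and ex: "(\<Sum>i\<in>I. a i * v0 i) = 0" "i0 \<in> I" "v0 i0 \<noteq> 0"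
  obtains v where "(\<Sum>i\<in>I. a i * v i) = 0" "(\<Sum>i\<in>I. m i * (v i)\<^sup>2) = 1"
    "\<And>u. (\<Sum>i\<in>I. a i * u i) = 0 \<Longrightarrow>
      bform I M u u \<le> bform I M v v * (\<Sum>i\<in>I. m i * (u i)\<^sup>2)"
proof -
  \<comment> \<open>A vector of weighted norm 1 has its coordinate at \<open>i\<close> in
    \<open>{- c i..c i}\<close>. Coordinates outside \<open>I\<close> are pinned to 0, so the unit
    sphere lies in a product of compact sets even over an infinite index type, and the form attains
    its maximum on it.\<close>
  define c where "c i = sqrt (1 / m i)" for i
  define P where "P = Pi\<^sub>E UNIV (\<lambda>i. if i \<in> I then {- c i..c i} else {0})"
  define K where "K = P \<inter> {v. (\<Sum>i\<in>I. a i * v i) = 0} \<inter> {v. (\<Sum>i\<in>I. m i * (v i)\<^sup>2) = 1}"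
  define S where "S u = (\<Sum>i\<in>I. m i * (u i)\<^sup>2)" for u :: "'i \<Rightarrow> real"
  have "compactin (product_topology (\<lambda>i. euclidean) UNIV) P"
    unfolding P_def by (subst compactin_PiE) auto
  then have "compact P" by (simp add: euclidean_product_topology)
  have coord: "continuous_on UNIV (\<lambda>v::'i \<Rightarrow> real. v i)" for i
    by (rule continuous_on_product_coordinates)
  have cont: "continuous_on UNIV (\<lambda>v::'i \<Rightarrow> real. \<Sum>i\<in>I. a i * v i)"
    "continuous_on UNIV (\<lambda>v::'i \<Rightarrow> real. \<Sum>i\<in>I. m i * (v i)\<^sup>2)"
    "continuous_on UNIV (\<lambda>v::'i \<Rightarrow> real. bform I M v v)"
    unfolding bform_def by (intro continuous_intros coord)+
  have "compact K" unfolding K_def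
    by (intro compact_Int_closed \<open>compact P\<close> closed_Collect_eq cont continuous_on_const)
  have scaled: "\<exists>w\<in>K. \<exists>t. \<forall>i\<in>I. u i = t * w i \<and> S u = t\<^sup>2"
    if u: "(\<Sum>i\<in>I. a i * u i) = 0" "S u \<noteq> 0" for u
  proof -
    have "S u \<ge> 0" unfolding S_def using m by (intro sum_nonneg) (simp add: less_imp_le)
    with u have S: "S u > 0" by simp
    define t where "t = sqrt (S u)"
    have t: "t > 0" "t\<^sup>2 = S u" using S by (auto simp: t_def)
    define w where "w i = (if i \<in> I then u i / t else 0)" for i
    have wS: "(\<Sum>i\<in>I. m i * (w i)\<^sup>2) = 1"
    proof -
      have "(\<Sum>i\<in>I. m i * (w i)\<^sup>2) = (\<Sum>i\<in>I. m i * (u i)\<^sup>2 / t\<^sup>2)"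
        by (intro sum.cong) (auto simp: w_def power_divide)
      also have "\<dots> = S u / t\<^sup>2" by (simp add: S_def sum_divide_distrib)
      finally show ?thesis using S t by simp
    qed
    have "w i \<in> {- c i..c i}" if "i \<in> I" for i
    proof -
      have "m i * (w i)\<^sup>2 \<le> (\<Sum>i\<in>I. m i * (w i)\<^sup>2)"
        using fin m that by (intro member_le_sum) (auto simp: less_imp_le)
      then have "(w i)\<^sup>2 \<le> 1 / m i" using wS m[OF that] by (simp add: field_simps)
      then have "\<bar>w i\<bar> \<le> c i" unfolding c_def by (simp add: real_le_rsqrt)
      then show ?thesis by auto
    qed
    then have "w \<in> P" by (auto simp: P_def w_def)
    moreover have "(\<Sum>i\<in>I. a i * w i) = (\<Sum>i\<in>I. a i * u i) / t"
      unfolding sum_divide_distrib by (intro sum.cong) (auto simp: w_def)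
    ultimately have "w \<in> K" using wS u by (simp add: K_def)
    moreover have "\<forall>i\<in>I. u i = t * w i \<and> S u = t\<^sup>2" using t by (simp add: w_def)
    ultimately show ?thesis by blast
  qed
  have "S v0 > 0" unfolding S_def
    using fin ex m by (intro sum_pos2[of _ i0]) (auto simp: less_imp_le)
  then have "K \<noteq> {}" using scaled[of v0] ex by auto
  from continuous_attains_sup[OF \<open>compact K\<close> this continuous_on_subset[OF cont(3)]]
  obtain v where v: "v \<in> K" "\<And>w. w \<in> K \<Longrightarrow> bform I M w w \<le> bform I M v v" by auto
  show ?thesis
  proof
    show "(\<Sum>i\<in>I. a i * v i) = 0" "(\<Sum>i\<in>I. m i * (v i)\<^sup>2) = 1" using v(1) by (auto simp: K_def)
    fix u assume u: "(\<Sum>i\<in>I. a i * u i) = 0"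
    show "bform I M u u \<le> bform I M v v * (\<Sum>i\<in>I. m i * (u i)\<^sup>2)"
    proof (cases "S u = 0")
      case True
      then have "\<forall>i\<in>I. m i * (u i)\<^sup>2 = 0" unfolding S_def
        using fin m by (subst (asm) sum_nonneg_eq_0_iff) (auto simp: less_imp_le)
      then have "\<forall>i\<in>I. u i = 0" using m by (metis less_irrefl mult_eq_0_iff power_eq_0_iff)
      then have "bform I M u u = 0" by (simp add: bform_def)
      with True show ?thesis by (simp add: S_def)
    next
      case False
      from scaled[OF u this] obtain w t where w: "w \<in> K" "\<And>i. i \<in> I \<Longrightarrow> u i = t * w i" "I \<noteq> {} \<longrightarrow> S u = t\<^sup>2"
        by blast
      have "I \<noteq> {}" using ex by auto
      have "bform I M u u = t\<^sup>2 * bform I M w w"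
        using bform_cong[of I u "\<lambda>i. t * w i" u "\<lambda>i. t * w i" M] w(2)
        by (simp add: bform_linear power2_eq_square)
      also have "\<dots> \<le> t\<^sup>2 * bform I M v v" using v(2)[OF w(1)] by (simp add: mult_left_mono)
      finally show ?thesis using w(3) \<open>I \<noteq> {}\<close> by (simp add: S_def mult.commute)
    qed
  qed
qed

lemma bform_restrict_support:
  assumes fin: "finite I" and sub: "J \<subseteq> I"
    and zero: "\<And>i j. i \<in> I \<Longrightarrow> j \<in> I \<Longrightarrow> i \<notin> J \<or> j \<notin> J \<Longrightarrow> M i j = 0"
  shows "bform I M u v = bform J M u v"
proof -
  have "bform I M u v = (\<Sum>i\<in>J. u i * (\<Sum>j\<in>I. M i j * v j))"
    unfolding bform_def using fin sub zero
    by (intro sum.mono_neutral_right) (auto intro!: sum.neutral)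
  also have "\<dots> = bform J M u v" unfolding bform_def
    using fin sub zero
    by (intro sum.cong arg_cong2[where f = "(*)"] refl sum.mono_neutral_right) auto
  finally show ?thesis .
qed

lemma double_sum_nonneg_0:
  fixes f :: "'i \<Rightarrow> 'i \<Rightarrow> real"
  assumes fin: "finite I" and nonneg: "\<And>i j. i \<in> I \<Longrightarrow> j \<in> I \<Longrightarrow> f i j \<ge> 0"
    and zero: "(\<Sum>i\<in>I. \<Sum>j\<in>I. f i j) = 0" and ij: "i \<in> I" "j \<in> I"
  shows "f i j = 0"
proof -
  have "(\<Sum>j\<in>I. f i j) = 0"
    by (rule sum_nonneg_0[OF fin sum_nonneg[OF nonneg] zero ij(1)])
  then show ?thesis by (rule sum_nonneg_0[rotated 2]) (use fin ij nonneg in auto)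
qed

text \<open>
  With \<open>m i = (M h) i\<close> and the inner product \<open>\<Sum> m i / h i * u i * v i\<close>, the operator
  \<open>v \<mapsto> (h i / m i) * (M v) i\<close> is self-adjoint and fixes \<open>h\<close>.  The hypothesis \<open>pull\<close> says that its
  eigenvalues avoid the open interval from 0 to 1, and the Laplacian identity says that they are
  at most 1, with eigenvalue 1 only on multiples of \<open>h\<close> when \<open>M\<close> is connected.
\<close>

lemma hyperbolic_of_pull_pos:
  assumes fin: "finite I" and sym: "\<forall>i\<in>I. \<forall>j\<in>I. M i j = M j i"
    and nonneg: "\<And>i j. i \<in> I \<Longrightarrow> j \<in> I \<Longrightarrow> M i j \<ge> 0"
    and h: "\<And>i. i \<in> I \<Longrightarrow> h i > 0"
    and pos: "\<And>i. i \<in> I \<Longrightarrow> (\<Sum>j\<in>I. M i j * h j) > 0"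
    and pull: "\<And>v. bform I M v v \<le> (\<Sum>i\<in>I. h i * (\<Sum>j\<in>I. M i j * v j)\<^sup>2 / (\<Sum>j\<in>I. M i j * h j))"
    and conn: "\<And>g i j. (\<And>i j. i \<in> I \<Longrightarrow> j \<in> I \<Longrightarrow> M i j \<noteq> 0 \<Longrightarrow> g i = (g j :: real)) \<Longrightarrow>
      i \<in> I \<Longrightarrow> j \<in> I \<Longrightarrow> g i = g j"
  shows "hyperbolic I M"
proof (rule hyperbolicI_orthogonal[OF sym])
  fix v0 assume orth: "bform I M v0 h = 0"
  show "bform I M v0 v0 \<le> 0"
  proof (rule ccontr)
    assume "\<not> bform I M v0 v0 \<le> 0"
    define m where "m i = (\<Sum>j\<in>I. M i j * h j)" for i
    define S where "S u v = (\<Sum>i\<in>I. m i / h i * u i * v i)" for u v :: "'a \<Rightarrow> real"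
    have m: "m i > 0" if "i \<in> I" for i using pos[OF that] by (simp add: m_def)
    have bh: "bform I M v h = (\<Sum>i\<in>I. m i * v i)" for v
      by (simp add: bform_def m_def mult.commute)
    have "\<exists>i\<in>I. v0 i \<noteq> 0"
    proof (rule ccontr)
      assume "\<not> ?thesis"
      then have "bform I M v0 v0 = 0" by (simp add: bform_def)
      with \<open>\<not> bform I M v0 v0 \<le> 0\<close> show False by simp
    qed
    then obtain i0 where i0: "i0 \<in> I" "v0 i0 \<noteq> 0" by blast
    have mh: "m i / h i > 0" if "i \<in> I" for i using m[OF that] h[OF that] by simp
    have orth': "(\<Sum>i\<in>I. m i * v0 i) = 0" using orth unfolding bh .
    obtain v where v: "(\<Sum>i\<in>I. m i * v i) = 0" "(\<Sum>i\<in>I. m i / h i * (v i)\<^sup>2) = 1"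
      and max: "\<And>u. (\<Sum>i\<in>I. m i * u i) = 0 \<Longrightarrow>
        bform I M u u \<le> bform I M v v * (\<Sum>i\<in>I. m i / h i * (u i)\<^sup>2)"
      by (rule quadratic_maximizer[OF fin mh orth' i0]) blast+
    have Suu: "(\<Sum>i\<in>I. m i / h i * (u i)\<^sup>2) = S u u" for u
      by (simp add: S_def power2_eq_square mult.assoc)
    \<comment> \<open>The largest eigenvalue on the complement of \<open>h\<close>, positive because
      of \<open>v0\<close>. It will be squeezed to 1 between \<open>pull\<close> and the Laplacian
      identity.\<close>
    define l where "l = bform I M v v"
    have "bform I M v0 v0 \<le> l * S v0 v0" using max[of v0] orth unfolding bh Suu l_def by blast
    moreover have "S v0 v0 \<ge> 0" unfolding Suu[symmetric]
      using m h by (intro sum_nonneg) (simp add: less_imp_le)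
    ultimately have l: "l > 0" using \<open>\<not> bform I M v0 v0 \<le> 0\<close>
      using mult_nonpos_nonneg[of l "S v0 v0"] by linarith
    have stationary: "bform I M v u = l * S v u" if u: "(\<Sum>i\<in>I. m i * u i) = 0" for u
    proof -
      have "2 * t * (bform I M v u - l * S v u) + t\<^sup>2 * (bform I M u u - l * S u u) \<le> 0" for t
      proof -
        have "(\<Sum>i\<in>I. m i * (v i + t * u i)) = (\<Sum>i\<in>I. m i * v i) + t * (\<Sum>i\<in>I. m i * u i)"
          by (simp add: algebra_simps sum.distrib sum_distrib_left)
        then have "bform I M (\<lambda>i. v i + t * u i) (\<lambda>i. v i + t * u i)
            \<le> l * S (\<lambda>i. v i + t * u i) (\<lambda>i. v i + t * u i)"
          using max[of "\<lambda>i. v i + t * u i"] u v unfolding l_def Suu by simp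
        moreover have "S (\<lambda>i. v i + t * u i) (\<lambda>i. v i + t * u i) = S v v + 2 * t * S v u + t\<^sup>2 * S u u"
          unfolding S_def sum_distrib_left sum.distrib[symmetric]
          by (intro sum.cong refl) (simp add: algebra_simps power2_eq_square add_divide_distrib)
        moreover have "S v v = 1" using v(2) unfolding Suu .
        ultimately show ?thesis
          unfolding bform_add_mult[OF sym] l_def[symmetric] by (simp add: algebra_simps)
      qed
      from linear_term_zero[OF this] show ?thesis by simp
    qed
    have eigen_form: "bform I M v u = l * S v u" for u
    proof (cases "I = {}")
      case True then show ?thesis by (simp add: bform_def S_def)
    next
      case False
      \<comment> \<open>Test vectors from the complement of \<open>h\<close> suffice, since
        \<open>v\<close> is orthogonal to \<open>h\<close> both for \<open>bform I M\<close> and for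
        \<open>S\<close>.\<close>
      define c where "c = - ((\<Sum>i\<in>I. m i * u i) / (\<Sum>i\<in>I. m i * h i))"
      have hpos: "(\<Sum>i\<in>I. m i * h i) > 0" using False fin m h by (intro sum_pos) auto
      have "(\<Sum>i\<in>I. m i * (u i + c * h i)) = (\<Sum>i\<in>I. m i * u i) + c * (\<Sum>i\<in>I. m i * h i)"
        by (simp add: algebra_simps sum.distrib sum_distrib_left)
      also have "\<dots> = 0" using hpos by (simp add: c_def)
      finally have "bform I M v (\<lambda>i. u i + c * h i) = l * S v (\<lambda>i. u i + c * h i)"
        by (rule stationary)
      moreover have "S v (\<lambda>i. u i + c * h i) = S v u + c * S v h"
        unfolding S_def sum_distrib_left sum.distrib[symmetric]
        by (intro sum.cong refl) (simp add: distrib_left)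
      moreover have "S v h = (\<Sum>i\<in>I. m i * v i)" unfolding S_def
        using h by (intro sum.cong refl) fastforce
      ultimately show ?thesis using v by (simp add: bform_linear bh)
    qed
    have eigen: "(\<Sum>j\<in>I. M i j * v j) = l * (m i / h i * v i)" if "i \<in> I" for i
    proof -
      have "(\<Sum>j\<in>I. M i j * v j) = bform I M v (\<lambda>j. if j = i then 1 else 0)"
        unfolding bform_sym[OF sym, where u = v] by (rule bform_point[OF fin that, symmetric])
      also have "\<dots> = l * (m i / h i * v i)" unfolding eigen_form S_def
        using fin that by (simp add: if_distrib[of "\<lambda>x. _ * x"] cong: if_cong)
      finally show ?thesis .
    qed
    have "l \<le> (\<Sum>i\<in>I. h i * (l * (m i / h i * v i))\<^sup>2 / m i)"
      using pull[of v] eigen by (simp add: l_def m_def)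
    also have "\<dots> = (\<Sum>i\<in>I. l\<^sup>2 * (m i / h i * (v i)\<^sup>2))"
    proof (intro sum.cong refl)
      fix i assume "i \<in> I"
      then have "m i > 0" "h i > 0" using m h by auto
      then show "h i * (l * (m i / h i * v i))\<^sup>2 / m i = l\<^sup>2 * (m i / h i * (v i)\<^sup>2)"
        by (simp add: field_simps power2_eq_square)
    qed
    also have "\<dots> = l\<^sup>2" unfolding sum_distrib_left[symmetric] v(2) by simp
    finally have "l \<ge> 1" using l by (simp add: power2_eq_square)
    define g where "g i = v i / h i" for i
    have lap: "(\<Sum>i\<in>I. \<Sum>j\<in>I. M i j * h i * h j * (g i - g j)\<^sup>2) = 2 * (1 - l)"
    proof -
      have "(\<Sum>i\<in>I. \<Sum>j\<in>I. M i j * h i * h j * (g i - g j)\<^sup>2) =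
          2 * ((\<Sum>i\<in>I. (\<Sum>j\<in>I. M i j * h j) * (v i)\<^sup>2 / h i) - bform I M v v)"
        unfolding g_def by (rule laplacian_identity[OF fin sym]) (rule h)
      also have "(\<Sum>i\<in>I. (\<Sum>j\<in>I. M i j * h j) * (v i)\<^sup>2 / h i) = 1"
        using v(2) by (simp add: m_def)
      finally show ?thesis by (simp add: l_def)
    qed
    have terms: "M i j * h i * h j * (g i - g j)\<^sup>2 \<ge> 0" if "i \<in> I" "j \<in> I" for i j
      using that nonneg h by (simp add: less_imp_le)
    have "g i = g j" if ij: "i \<in> I" "j \<in> I" "M i j \<noteq> 0" for i j
    proof -
      have "(\<Sum>i\<in>I. \<Sum>j\<in>I. M i j * h i * h j * (g i - g j)\<^sup>2) = 0"
        using lap \<open>l \<ge> 1\<close> terms by (intro antisym sum_nonneg) auto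
      then have "M i j * h i * h j * (g i - g j)\<^sup>2 = 0"
        using fin terms ij by (intro double_sum_nonneg_0[of I "\<lambda>i j. M i j * h i * h j * (g i - g j)\<^sup>2"])
      then show ?thesis using ij h[of i] h[of j] by auto
    qed
    \<comment> \<open>So \<open>v\<close> is a multiple of \<open>h\<close>; being orthogonal to
      \<open>h\<close> it is 0, against its norm 1.\<close>
    then have const: "g i = g i0" if "i \<in> I" for i using conn that i0(1) by blast
    have g: "v i = g i0 * h i" if "i \<in> I" for i
      unfolding const[OF that, symmetric] using h[OF that] by (simp add: g_def)
    have "0 = (\<Sum>i\<in>I. m i * v i)" using v by simp
    also have "\<dots> = g i0 * (\<Sum>i\<in>I. m i * h i)" unfolding sum_distrib_left
      by (intro sum.cong) (auto simp: g)
    finally have "g i0 * (\<Sum>i\<in>I. m i * h i) = 0" by simp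
    moreover have "(\<Sum>i\<in>I. m i * h i) > 0"
      using i0 m h by (intro sum_pos fin) auto
    ultimately have "g i0 = 0" by simp
    then have "(\<Sum>i\<in>I. m i / h i * (v i)\<^sup>2) = 0" using g by (intro sum.neutral) simp
    with v(2) show False by linarith
  qed
qed

lemma hyperbolic_of_pull:
  assumes fin: "finite I" and sym: "\<forall>i\<in>I. \<forall>j\<in>I. M i j = M j i"
    and nonneg: "\<And>i j. i \<in> I \<Longrightarrow> j \<in> I \<Longrightarrow> M i j \<ge> 0"
    and h: "\<And>i. i \<in> I \<Longrightarrow> h i > 0"
    and pull: "\<And>v. bform I M v v \<le> (\<Sum>i\<in>I. h i * (\<Sum>j\<in>I. M i j * v j)\<^sup>2 / (\<Sum>j\<in>I. M i j * h j))"
    and conn: "\<And>g i j. (\<And>i j. i \<in> I \<Longrightarrow> j \<in> I \<Longrightarrow> M i j \<noteq> 0 \<Longrightarrow> g i = (g j :: real)) \<Longrightarrow>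
      i \<in> I \<Longrightarrow> j \<in> I \<Longrightarrow> (\<Sum>k\<in>I. M i k * h k) > 0 \<Longrightarrow> (\<Sum>k\<in>I. M j k * h k) > 0 \<Longrightarrow> g i = g j"
  shows "hyperbolic I M"
proof -
  define J where "J = {i \<in> I. (\<Sum>k\<in>I. M i k * h k) > 0}"
  have sub: "J \<subseteq> I" by (auto simp: J_def)
  have row0: "M i j = 0" if "i \<in> I" "i \<notin> J" "j \<in> I" for i j
  proof -
    have n: "M i k * h k \<ge> 0" if "k \<in> I" for k
      using \<open>i \<in> I\<close> that nonneg h by (simp add: less_imp_le)
    have "(\<Sum>k\<in>I. M i k * h k) = 0"
      using that n by (intro antisym sum_nonneg) (auto simp: J_def)
    then have "M i j * h j = 0" using fin n that by (simp add: sum_nonneg_eq_0_iff)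
    then show ?thesis using h[of j] that by auto
  qed
  have zero: "M i j = 0" if "i \<in> I" "j \<in> I" "i \<notin> J \<or> j \<notin> J" for i j
    using that row0[of i j] row0[of j i] sym by auto
  have form: "bform I M u v = bform J M u v" for u v
    by (rule bform_restrict_support[OF fin sub]) (rule zero)
  have row: "(\<Sum>j\<in>J. M i j * w j) = (\<Sum>j\<in>I. M i j * w j)" if "i \<in> J" for i w
    using fin sub zero that by (intro sum.mono_neutral_left) auto
  have "hyperbolic J M"
  proof (rule hyperbolic_of_pull_pos[where h = h])
    show "finite J" using fin sub by (rule rev_finite_subset)
    show "\<forall>i\<in>J. \<forall>j\<in>J. M i j = M j i" using sym sub by blast
    show "M i j \<ge> 0" if "i \<in> J" "j \<in> J" for i j using nonneg sub that by blast
    show "h i > 0" if "i \<in> J" for i using h sub that by blast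
    show "(\<Sum>j\<in>J. M i j * h j) > 0" if "i \<in> J" for i
      unfolding row[OF that] using that by (simp add: J_def)
    show "bform J M v v \<le> (\<Sum>i\<in>J. h i * (\<Sum>j\<in>J. M i j * v j)\<^sup>2 / (\<Sum>j\<in>J. M i j * h j))" for v
    proof -
      have "bform J M v v \<le> (\<Sum>i\<in>I. h i * (\<Sum>j\<in>I. M i j * v j)\<^sup>2 / (\<Sum>j\<in>I. M i j * h j))"
        using pull[of v] by (simp add: form)
      also have "\<dots> = (\<Sum>i\<in>J. h i * (\<Sum>j\<in>I. M i j * v j)\<^sup>2 / (\<Sum>j\<in>I. M i j * h j))"
        using fin sub row0 by (intro sum.mono_neutral_right) auto
      also have "\<dots> = (\<Sum>i\<in>J. h i * (\<Sum>j\<in>J. M i j * v j)\<^sup>2 / (\<Sum>j\<in>J. M i j * h j))"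
        by (intro sum.cong refl) (simp add: row)
      finally show ?thesis .
    qed
    fix g :: "'a \<Rightarrow> real" and i j
    assume g: "\<And>i j. i \<in> J \<Longrightarrow> j \<in> J \<Longrightarrow> M i j \<noteq> 0 \<Longrightarrow> g i = g j" and "i \<in> J" "j \<in> J"
    show "g i = g j"
    proof (rule conn)
      show "g i = g j" if "i \<in> I" "j \<in> I" "M i j \<noteq> 0" for i j using g zero that by blast
    qed (use \<open>i \<in> J\<close> \<open>j \<in> J\<close> in \<open>auto simp: J_def\<close>)
  qed
  then show ?thesis by (simp add: hyperbolic_def form)
qed

text \<open>Positivity at \<open>v\<close> is an open condition and the inequality a closed one, so
  it survives \<open>t \<rightarrow> 0\<close> from the right.\<close>

lemma hyperbolic_limit:
  assumes "\<And>t. t > 0 \<Longrightarrow> hyperbolic I (\<lambda>i j. M i j + t * N i j)"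
  shows "hyperbolic I M"
  unfolding hyperbolic_def
proof (intro allI impI)
  fix u v assume pos: "bform I M v v > 0"
  have form: "bform I (\<lambda>i j. M i j + t * N i j) u' v' = bform I M u' v' + t * bform I N u' v'"
    for t u' v'
    by (simp add: bform_def sum_distrib_left sum.distrib algebra_simps)
  let ?Q = "\<lambda>u v t. bform I M u v + t * bform I N u v"
  have lim: "(?Q u' v' \<longlongrightarrow> bform I M u' v') (at_right 0)" for u' v'
    by (rule tendsto_eq_intros refl | simp)+
  have "eventually (\<lambda>t. ?Q v v t > 0) (at_right 0)"
    using order_tendstoD(1)[OF lim pos] .
  moreover have "eventually (\<lambda>t::real. t > 0) (at_right 0)" by (rule eventually_at_right_less)
  ultimately have "eventually (\<lambda>t. ?Q u u t * ?Q v v t \<le> (?Q u v t)\<^sup>2) (at_right 0)"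
  proof eventually_elim
    case (elim t)
    with assms[of t] show ?case unfolding hyperbolic_def form by blast
  qed
  then show "bform I M u u * bform I M v v \<le> (bform I M u v)\<^sup>2"
    by (intro tendsto_le[OF _ tendsto_power[OF lim] tendsto_mult[OF lim lim]]) simp_all
qed

text \<open>For two indices, the right side of the hyperbolic inequality minus its left side is a
  square times minus the determinant of \<open>M\<close>.\<close>

lemma hyperbolic_pair:
  assumes sub: "I \<subseteq> {i, j}" and ne: "i \<noteq> j" and sym: "M j i = M i j"
    and det: "i \<in> I \<Longrightarrow> j \<in> I \<Longrightarrow> M i i * M j j \<le> (M i j)\<^sup>2"
  shows "hyperbolic I M"
  unfolding hyperbolic_def
proof (intro allI impI)
  fix u v
  consider "I = {}" | "I = {i}" | "I = {j}" | "I = {i, j}" using sub by blast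
  then show "bform I M u u * bform I M v v \<le> (bform I M u v)\<^sup>2"
  proof cases
    case 4
    then have "(bform I M u v)\<^sup>2 - bform I M u u * bform I M v v
        = ((M i j)\<^sup>2 - M i i * M j j) * (u i * v j - u j * v i)\<^sup>2"
      using ne sym by (simp add: bform_def power2_eq_square algebra_simps)
    moreover have "\<dots> \<ge> 0" using det 4 by (intro mult_nonneg_nonneg) auto
    ultimately show ?thesis by simp
  qed (simp_all add: bform_def power2_eq_square)
qed

lemma bform_eq_0:
  assumes fin: "finite I" and nonneg: "\<And>i j. i \<in> I \<Longrightarrow> j \<in> I \<Longrightarrow> M i j \<ge> 0"
    and h: "\<And>i. i \<in> I \<Longrightarrow> h i > 0" and zero: "bform I M h h = 0"
  shows "bform I M u v = 0"
proof -
  have "M i j = 0" if ij: "i \<in> I" "j \<in> I" for i j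
  proof -
    have "h i * (M i j * h j) = 0"
    proof (rule double_sum_nonneg_0[OF fin _ _ ij])
      show "h i * (M i j * h j) \<ge> 0" if "i \<in> I" "j \<in> I" for i j
        using that nonneg h by (simp add: less_imp_le)
      show "(\<Sum>i\<in>I. \<Sum>j\<in>I. h i * (M i j * h j)) = 0"
        using zero by (simp add: bform_def sum_distrib_left)
    qed
    then show ?thesis using h[OF ij(1)] h[OF ij(2)] by simp
  qed
  then show ?thesis by (simp add: bform_def)
qed

lemma double_sum_antisym:
  fixes G :: "'i \<Rightarrow> 'i \<Rightarrow> real"
  assumes "\<And>i j. i \<in> I \<Longrightarrow> j \<in> I \<Longrightarrow> G i j + G j i \<ge> 0"
  shows "(\<Sum>i\<in>I. \<Sum>j\<in>I. G i j) \<ge> 0"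
proof -
  have "0 \<le> (\<Sum>i\<in>I. \<Sum>j\<in>I. G i j + G j i)" using assms by (intro sum_nonneg)
  also have "\<dots> = 2 * (\<Sum>i\<in>I. \<Sum>j\<in>I. G i j)"
    using sum.swap[of "\<lambda>i j. G j i" I I] by (simp add: sum.distrib)
  finally show ?thesis by simp
qed

lemma sum_nonpos_eq_0:
  fixes f :: "'i \<Rightarrow> real"
  assumes "finite I" "\<And>i. i \<in> I \<Longrightarrow> f i \<le> 0" "(\<Sum>i\<in>I. f i) \<ge> 0" "i \<in> I"
  shows "f i = 0"
proof -
  have "(\<Sum>i\<in>I. - f i) = 0"
    using assms by (intro antisym sum_nonneg) (auto simp: sum_negf)
  then have "- f i = 0"
    by (rule sum_nonneg_0[rotated 2]) (use assms in auto)
  then show ?thesis by simp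
qed

section \<open>Linear extensions\<close>

text \<open>By counting, an injection into \<open>{1..card R}\<close> is onto, so the constructions
  below need only injectivity and bounds.\<close>

lemma linear_extensions_at_iff:
  assumes "finite R"
  shows "L \<in> linear_extensions_at R r z k \<longleftrightarrow>
    L \<in> extensional R \<and> inj_on L R \<and> (\<forall>x\<in>R. 1 \<le> L x \<and> L x \<le> card R) \<and>
    (\<forall>x\<in>R. \<forall>y\<in>R. prec r x y \<longrightarrow> L x < L y) \<and> L z = k"
proof -
  have "bij_betw L R {1..card R} \<longleftrightarrow> inj_on L R \<and> (\<forall>x\<in>R. 1 \<le> L x \<and> L x \<le> card R)"
  proof
    assume "inj_on L R \<and> (\<forall>x\<in>R. 1 \<le> L x \<and> L x \<le> card R)"
    moreover from this have "L ` R = {1..card R}"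
      by (intro card_subset_eq) (auto simp: card_image)
    ultimately show "bij_betw L R {1..card R}" by (simp add: bij_betw_def)
  qed (auto simp: bij_betw_def)
  then show ?thesis by (auto simp: linear_extensions_at_def linear_extensions_def)
qed

lemma linear_extensions_at_surj:
  assumes "L \<in> linear_extensions_at R r z k" "1 \<le> m" "m \<le> card R"
  obtains x where "x \<in> R" "L x = m"
proof -
  have "L ` R = {1..card R}"
    using assms(1) by (simp add: linear_extensions_at_def linear_extensions_def bij_betw_def)
  then have "m \<in> L ` R" using assms by simp
  then show ?thesis using that by blast
qed

lemma finite_linear_extensions_at:
  assumes "finite R"
  shows "finite (linear_extensions_at R r z k)"
proof (rule finite_subset)
  show "linear_extensions_at R r z k \<subseteq> PiE R (\<lambda>_. {1..card R})"
    using assms by (auto simp: linear_extensions_at_iff PiE_def)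
qed (use assms in \<open>simp add: finite_PiE\<close>)

section \<open>Removing and restoring the first or the last element\<close>

definition prepend :: "'a set \<Rightarrow> 'a \<Rightarrow> ('a \<Rightarrow> nat) \<Rightarrow> 'a \<Rightarrow> nat" where
  "prepend R x L = (\<lambda>y\<in>R. if y = x then 1 else Suc (L y))"

definition behead :: "'a set \<Rightarrow> 'a \<Rightarrow> ('a \<Rightarrow> nat) \<Rightarrow> 'a \<Rightarrow> nat" where
  "behead R x L = (\<lambda>y\<in>R - {x}. L y - 1)"

definition append_last :: "'a set \<Rightarrow> 'a \<Rightarrow> ('a \<Rightarrow> nat) \<Rightarrow> 'a \<Rightarrow> nat" where
  "append_last R x L = (\<lambda>y\<in>R. if y = x then card R else L y)"

text \<open>\<open>z\<close> is left out because it has to survive every removal.\<close>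

definition mins :: "'a rel \<Rightarrow> 'a \<Rightarrow> 'a set \<Rightarrow> 'a set" where
  "mins r z R = {x \<in> R. x \<noteq> z \<and> (\<forall>y\<in>R. \<not> prec r y x)}"

definition maxs :: "'a rel \<Rightarrow> 'a \<Rightarrow> 'a set \<Rightarrow> 'a set" where
  "maxs r z R = {x \<in> R. x \<noteq> z \<and> (\<forall>y\<in>R. \<not> prec r x y)}"

lemma prepend_in:
  assumes fin: "finite R" and z: "z \<in> R" and x: "x \<in> mins r z R"
    and L: "L \<in> linear_extensions_at (R - {x}) r z k"
  shows "prepend R x L \<in> linear_extensions_at R r z (Suc k)"
proof -
  have xR: "x \<in> R" "x \<noteq> z" "\<And>y. y \<in> R \<Longrightarrow> \<not> prec r y x" using x by (auto simp: mins_def)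
  have card: "card (R - {x}) = card R - 1" "card R \<ge> 1"
    using fin xR by (auto simp: Suc_le_eq card_gt_0_iff)
  have L': "inj_on L (R - {x})" "\<And>y. y \<in> R \<Longrightarrow> y \<noteq> x \<Longrightarrow> 1 \<le> L y \<and> L y \<le> card (R - {x})"
    "\<And>y w. y \<in> R \<Longrightarrow> y \<noteq> x \<Longrightarrow> w \<in> R \<Longrightarrow> w \<noteq> x \<Longrightarrow> prec r y w \<Longrightarrow> L y < L w" "L z = k"
    using L fin by (auto simp: linear_extensions_at_iff)
  have "inj_on (prepend R x L) (insert x (R - {x}))"
    unfolding inj_on_insert
  proof
    show "inj_on (prepend R x L) (R - {x})" using L'(1) by (simp add: inj_on_def prepend_def)
    show "prepend R x L x \<notin> prepend R x L ` (R - {x} - {x})"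
      using xR(1) L'(2) by (fastforce simp: prepend_def)
  qed
  then have "inj_on (prepend R x L) R" using xR(1) by (simp add: insert_absorb)
  moreover have "1 \<le> prepend R x L y \<and> prepend R x L y \<le> card R" if "y \<in> R" for y
    using that L'(2)[of y] card by (auto simp: prepend_def)
  moreover have "prepend R x L y < prepend R x L w" if "y \<in> R" "w \<in> R" "prec r y w" for y w
    using that L'(2)[of w] L'(3)[of y w] xR by (auto simp: prepend_def)
  moreover have "prepend R x L z = Suc k" using z xR L' by (simp add: prepend_def)
  moreover have "prepend R x L \<in> extensional R" by (simp add: prepend_def)
  ultimately show ?thesis using fin by (simp add: linear_extensions_at_iff)
qed

lemma behead_in:
  assumes fin: "finite R" and z: "z \<in> R" and L: "L \<in> linear_extensions_at R r z (Suc k)"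
    and k: "k \<ge> 1" and x: "x \<in> R" "L x = 1"
  shows "x \<in> mins r z R" "behead R x L \<in> linear_extensions_at (R - {x}) r z k"
proof -
  have L': "L \<in> extensional R" "inj_on L R" "\<And>y. y \<in> R \<Longrightarrow> 1 \<le> L y \<and> L y \<le> card R"
    "\<And>y w. y \<in> R \<Longrightarrow> w \<in> R \<Longrightarrow> prec r y w \<Longrightarrow> L y < L w" "L z = Suc k"
    using L fin by (auto simp: linear_extensions_at_iff)
  have "x \<noteq> z" using x L' k by auto
  moreover have "\<not> prec r y x" if "y \<in> R" for y
    using L'(4)[OF that x(1)] L'(3)[OF that] x by auto
  ultimately show "x \<in> mins r z R" using x by (simp add: mins_def)
  have card: "card (R - {x}) = card R - 1" "card R \<ge> 1"
    using fin x by (auto simp: Suc_le_eq card_gt_0_iff)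
  have gt: "L y > 1" if "y \<in> R" "y \<noteq> x" for y
    using that L'(2,3) x by (metis inj_onD le_neq_implies_less)
  have "inj_on (behead R x L) (R - {x})"
  proof (rule inj_onI)
    fix y w assume yw: "y \<in> R - {x}" "w \<in> R - {x}" "behead R x L y = behead R x L w"
    then have "L y = L w" using gt[of y] gt[of w] by (auto simp: behead_def)
    then show "y = w" using yw inj_onD[OF L'(2)] by blast
  qed
  moreover have "1 \<le> behead R x L y \<and> behead R x L y \<le> card (R - {x})" if "y \<in> R - {x}" for y
    using that gt[of y] L'(3)[of y] card by (auto simp: behead_def)
  moreover have "behead R x L y < behead R x L w"
    if "y \<in> R - {x}" "w \<in> R - {x}" "prec r y w" for y w
    using that gt[of y] gt[of w] L'(4)[of y w] by (auto simp: behead_def)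
  moreover have "behead R x L z = k" using z \<open>x \<noteq> z\<close> L' by (simp add: behead_def)
  moreover have "behead R x L \<in> extensional (R - {x})" by (simp add: behead_def)
  ultimately show "behead R x L \<in> linear_extensions_at (R - {x}) r z k"
    using fin by (simp add: linear_extensions_at_iff)
qed

lemma append_last_in:
  assumes fin: "finite R" and z: "z \<in> R" and x: "x \<in> maxs r z R"
    and L: "L \<in> linear_extensions_at (R - {x}) r z k"
  shows "append_last R x L \<in> linear_extensions_at R r z k"
proof -
  have xR: "x \<in> R" "x \<noteq> z" "\<And>y. y \<in> R \<Longrightarrow> \<not> prec r x y" using x by (auto simp: maxs_def)
  have card: "card (R - {x}) = card R - 1" "card R \<ge> 1"
    using fin xR by (auto simp: Suc_le_eq card_gt_0_iff)
  have L': "inj_on L (R - {x})" "\<And>y. y \<in> R \<Longrightarrow> y \<noteq> x \<Longrightarrow> 1 \<le> L y \<and> L y \<le> card (R - {x})"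
    "\<And>y w. y \<in> R \<Longrightarrow> y \<noteq> x \<Longrightarrow> w \<in> R \<Longrightarrow> w \<noteq> x \<Longrightarrow> prec r y w \<Longrightarrow> L y < L w" "L z = k"
    using L fin by (auto simp: linear_extensions_at_iff)
  have "inj_on (append_last R x L) (insert x (R - {x}))"
    unfolding inj_on_insert
  proof
    show "inj_on (append_last R x L) (R - {x})" using L'(1) by (simp add: inj_on_def append_last_def)
    show "append_last R x L x \<notin> append_last R x L ` (R - {x} - {x})"
      using xR(1) L'(2) card by (fastforce simp: append_last_def)
  qed
  then have "inj_on (append_last R x L) R" using xR(1) by (simp add: insert_absorb)
  moreover have "1 \<le> append_last R x L y \<and> append_last R x L y \<le> card R" if "y \<in> R" for y
    using that L'(2)[of y] card by (auto simp: append_last_def)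
  moreover have "append_last R x L y < append_last R x L w" if "y \<in> R" "w \<in> R" "prec r y w" for y w
  proof (cases "y = x")
    case True with that xR show ?thesis by blast
  next
    case False
    then show ?thesis using that L'(2)[of y] L'(3)[of y w] card by (auto simp: append_last_def)
  qed
  moreover have "append_last R x L z = k" using z xR L' by (simp add: append_last_def)
  moreover have "append_last R x L \<in> extensional R" by (simp add: append_last_def)
  ultimately show ?thesis using fin by (simp add: linear_extensions_at_iff)
qed

lemma restrict_last_in:
  assumes fin: "finite R" and z: "z \<in> R" and L: "L \<in> linear_extensions_at R r z k"
    and k: "k < card R" and x: "x \<in> R" "L x = card R"
  shows "x \<in> maxs r z R" "restrict L (R - {x}) \<in> linear_extensions_at (R - {x}) r z k"
proof -
  have L': "L \<in> extensional R" "inj_on L R" "\<And>y. y \<in> R \<Longrightarrow> 1 \<le> L y \<and> L y \<le> card R"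
    "\<And>y w. y \<in> R \<Longrightarrow> w \<in> R \<Longrightarrow> prec r y w \<Longrightarrow> L y < L w" "L z = k"
    using L fin by (auto simp: linear_extensions_at_iff)
  have "x \<noteq> z" using x L' k by auto
  moreover have "\<not> prec r x y" if "y \<in> R" for y
    using L'(4)[OF x(1) that] L'(3)[OF that] x by auto
  ultimately show "x \<in> maxs r z R" using x by (simp add: maxs_def)
  have card: "card (R - {x}) = card R - 1" "card R \<ge> 1"
    using fin x by (auto simp: Suc_le_eq card_gt_0_iff)
  have lt: "L y < card R" if "y \<in> R" "y \<noteq> x" for y
    using that L'(2,3) x by (metis inj_onD le_neq_implies_less)
  have "inj_on (restrict L (R - {x})) (R - {x})"
    using inj_on_subset[OF L'(2), of "R - {x}"] by (simp add: inj_on_def)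
  moreover have "1 \<le> L y \<and> L y \<le> card (R - {x})" if "y \<in> R" "y \<noteq> x" for y
    using that lt[of y] L'(3)[of y] card by auto
  ultimately show "restrict L (R - {x}) \<in> linear_extensions_at (R - {x}) r z k"
    using fin L'(4,5) z \<open>x \<noteq> z\<close> by (simp add: linear_extensions_at_iff)
qed

lemma N_weighted_nonneg:
  assumes "\<And>x. x \<in> R \<Longrightarrow> \<omega> x > 0"
  shows "N_weighted R r \<omega> z k \<ge> 0"
  unfolding N_weighted_def ext_weight_def using assms
  by (intro sum_nonneg prod_nonneg) (auto simp: less_imp_le)

lemma N_weighted_pos_iff:
  assumes "finite R" "\<And>x. x \<in> R \<Longrightarrow> \<omega> x > 0"
  shows "N_weighted R r \<omega> z k > 0 \<longleftrightarrow> linear_extensions_at R r z k \<noteq> {}"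
proof
  show "linear_extensions_at R r z k \<noteq> {} \<Longrightarrow> N_weighted R r \<omega> z k > 0"
    unfolding N_weighted_def ext_weight_def using assms
    by (intro sum_pos finite_linear_extensions_at prod_pos) auto
qed (auto simp: N_weighted_def)

text \<open>Extensions are sorted by their first element, which is not \<open>z\<close> because
  \<open>Suc k > 1\<close>. It lies below \<open>z\<close>, hence the factor
  \<open>\<omega> x\<close> and the shift in the position of \<open>z\<close>.\<close>

lemma N_weighted_mins:
  assumes fin: "finite R" and z: "z \<in> R" and k: "k \<ge> 1"
  shows "N_weighted R r \<omega> z (Suc k) = (\<Sum>x\<in>mins r z R. \<omega> x * N_weighted (R - {x}) r \<omega> z k)"
proof -
  let ?E = "\<lambda>R k. linear_extensions_at R r z k"
  let ?T = "Sigma (mins r z R) (\<lambda>x. ?E (R - {x}) k)"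
  have finm: "finite (mins r z R)" using fin by (simp add: mins_def)
  have wt: "ext_weight R \<omega> z (prepend R x L) = \<omega> x * ext_weight (R - {x}) \<omega> z L"
    if "x \<in> mins r z R" "L \<in> ?E (R - {x}) k" for x L
  proof -
    have xR: "x \<in> R" "x \<noteq> z" using that by (auto simp: mins_def)
    have "L z \<ge> 1" using that fin z xR by (auto simp: linear_extensions_at_iff)
    then have "{y \<in> R. prepend R x L y < prepend R x L z} = insert x {y \<in> R - {x}. L y < L z}"
      using xR z by (auto simp: prepend_def split: if_splits)
    then show ?thesis using fin by (simp add: ext_weight_def)
  qed
  have first: "\<exists>!x. x \<in> R \<and> L x = 1" if L: "L \<in> ?E R (Suc k)" for L
  proof -
    have "card R \<ge> 1" using fin z by (metis One_nat_def Suc_leI card_gt_0_iff empty_iff)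
    then obtain x where "x \<in> R" "L x = 1" using linear_extensions_at_surj[OF L, of 1] by auto
    moreover have "inj_on L R" using that fin by (simp add: linear_extensions_at_iff)
    ultimately show ?thesis by (metis inj_onD)
  qed
  define fst_el where "fst_el L = (THE x. x \<in> R \<and> L x = (1::nat))" for L
  have fst_el: "fst_el L \<in> R" "L (fst_el L) = 1" if "L \<in> ?E R (Suc k)" for L
    using theI'[OF first[OF that]] by (auto simp: fst_el_def)
  have "N_weighted R r \<omega> z (Suc k) = (\<Sum>(x, L)\<in>?T. ext_weight R \<omega> z (prepend R x L))"
    unfolding N_weighted_def
  proof (rule sum.reindex_bij_witness[where i = "\<lambda>(x, L). prepend R x L"
        and j = "\<lambda>L. (fst_el L, behead R (fst_el L) L)"])
    fix L assume L: "L \<in> ?E R (Suc k)"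
    note f = fst_el[OF L]
    have inj: "inj_on L R" and ge: "\<And>y. y \<in> R \<Longrightarrow> 1 \<le> L y" and ext: "L \<in> extensional R"
      using L fin by (auto simp: linear_extensions_at_iff)
    have "prepend R (fst_el L) (behead R (fst_el L) L) = L"
    proof
      fix y show "prepend R (fst_el L) (behead R (fst_el L) L) y = L y"
        using f ge[of y] ext by (auto simp: prepend_def behead_def extensional_def)
    qed
    then show "(case (fst_el L, behead R (fst_el L) L) of (x, L) \<Rightarrow> prepend R x L) = L"
      "(case (fst_el L, behead R (fst_el L) L) of (x, L) \<Rightarrow> ext_weight R \<omega> z (prepend R x L))
        = ext_weight R \<omega> z L" by auto
    show "(fst_el L, behead R (fst_el L) L) \<in> ?T" using behead_in[OF fin z L k f] by simp
  next
    fix p assume p: "p \<in> ?T"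
    obtain x L where [simp]: "p = (x, L)" by force
    have x: "x \<in> mins r z R" "x \<in> R" and L: "L \<in> ?E (R - {x}) k" using p by (auto simp: mins_def)
    have P: "prepend R x L \<in> ?E R (Suc k)" by (rule prepend_in[OF fin z x(1) L])
    then show "(case p of (x, L) \<Rightarrow> prepend R x L) \<in> ?E R (Suc k)" by simp
    have e: "fst_el (prepend R x L) = x"
      unfolding fst_el_def using x by (intro the1_equality[OF first[OF P]]) (simp add: prepend_def)
    have "behead R x (prepend R x L) = L"
    proof
      fix y show "behead R x (prepend R x L) y = L y"
        using L fin by (auto simp: linear_extensions_at_iff prepend_def behead_def extensional_def)
    qed
    with e show "(fst_el (case p of (x, L) \<Rightarrow> prepend R x L),
        behead R (fst_el (case p of (x, L) \<Rightarrow> prepend R x L)) (case p of (x, L) \<Rightarrow> prepend R x L)) = p"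
      by simp
  qed
  also have "\<dots> = (\<Sum>(x, L)\<in>?T. \<omega> x * ext_weight (R - {x}) \<omega> z L)"
    by (intro sum.cong) (auto simp: wt)
  also have "\<dots> = (\<Sum>x\<in>mins r z R. \<Sum>L\<in>?E (R - {x}) k. \<omega> x * ext_weight (R - {x}) \<omega> z L)"
    using fin finm by (intro sum.Sigma[symmetric]) (auto intro: finite_linear_extensions_at)
  finally show ?thesis by (simp add: N_weighted_def sum_distrib_left)
qed

text \<open>The last element stands above \<open>z\<close>, so it contributes no weight and does not
  move \<open>z\<close>; \<open>k < card R\<close> keeps \<open>z\<close> itself from being
  last.\<close>

lemma N_weighted_maxs:
  assumes fin: "finite R" and z: "z \<in> R" and k: "k < card R"
  shows "N_weighted R r \<omega> z k = (\<Sum>x\<in>maxs r z R. N_weighted (R - {x}) r \<omega> z k)"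
proof -
  let ?E = "\<lambda>R k. linear_extensions_at R r z k"
  let ?T = "Sigma (maxs r z R) (\<lambda>x. ?E (R - {x}) k)"
  have finm: "finite (maxs r z R)" using fin by (simp add: maxs_def)
  have wt: "ext_weight R \<omega> z (append_last R x L) = ext_weight (R - {x}) \<omega> z L"
    if "x \<in> maxs r z R" "L \<in> ?E (R - {x}) k" for x L
  proof -
    have xR: "x \<in> R" "x \<noteq> z" using that by (auto simp: maxs_def)
    have "L z < card R" using that k fin by (auto simp: linear_extensions_at_iff)
    then have "{y \<in> R. append_last R x L y < append_last R x L z} = {y \<in> R - {x}. L y < L z}"
      using xR z by (auto simp: append_last_def split: if_splits)
    then show ?thesis using fin by (simp add: ext_weight_def)
  qed
  have lst: "\<exists>!x. x \<in> R \<and> L x = card R" if L: "L \<in> ?E R k" for L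
  proof -
    have "card R \<ge> 1" using fin z by (metis One_nat_def Suc_leI card_gt_0_iff empty_iff)
    then obtain x where "x \<in> R" "L x = card R"
      using linear_extensions_at_surj[OF L, of "card R"] by auto
    moreover have "inj_on L R" using that fin by (simp add: linear_extensions_at_iff)
    ultimately show ?thesis by (metis inj_onD)
  qed
  define lst_el where "lst_el L = (THE x. x \<in> R \<and> L x = card R)" for L
  have lst_el: "lst_el L \<in> R" "L (lst_el L) = card R" if "L \<in> ?E R k" for L
    using theI'[OF lst[OF that]] by (auto simp: lst_el_def)
  have "N_weighted R r \<omega> z k = (\<Sum>(x, L)\<in>?T. ext_weight R \<omega> z (append_last R x L))"
    unfolding N_weighted_def
  proof (rule sum.reindex_bij_witness[where i = "\<lambda>(x, L). append_last R x L"
        and j = "\<lambda>L. (lst_el L, restrict L (R - {lst_el L}))"])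
    fix L assume L: "L \<in> ?E R k"
    note f = lst_el[OF L]
    have ext: "L \<in> extensional R" using L fin by (auto simp: linear_extensions_at_iff)
    have "append_last R (lst_el L) (restrict L (R - {lst_el L})) = L"
    proof
      fix y show "append_last R (lst_el L) (restrict L (R - {lst_el L})) y = L y"
        using f ext by (auto simp: append_last_def extensional_def)
    qed
    then show "(case (lst_el L, restrict L (R - {lst_el L})) of (x, L) \<Rightarrow> append_last R x L) = L"
      "(case (lst_el L, restrict L (R - {lst_el L})) of (x, L) \<Rightarrow>
        ext_weight R \<omega> z (append_last R x L)) = ext_weight R \<omega> z L" by auto
    show "(lst_el L, restrict L (R - {lst_el L})) \<in> ?T" using restrict_last_in[OF fin z L k f] by simp
  next
    fix p assume p: "p \<in> ?T"
    obtain x L where [simp]: "p = (x, L)" by force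
    have x: "x \<in> maxs r z R" "x \<in> R" and L: "L \<in> ?E (R - {x}) k" using p by (auto simp: maxs_def)
    have P: "append_last R x L \<in> ?E R k" by (rule append_last_in[OF fin z x(1) L])
    then show "(case p of (x, L) \<Rightarrow> append_last R x L) \<in> ?E R k" by simp
    have e: "lst_el (append_last R x L) = x"
      unfolding lst_el_def using x by (intro the1_equality[OF lst[OF P]]) (simp add: append_last_def)
    have "restrict (append_last R x L) (R - {x}) = L"
    proof
      fix y show "restrict (append_last R x L) (R - {x}) y = L y"
        using L fin by (auto simp: linear_extensions_at_iff append_last_def extensional_def)
    qed
    with e show "(lst_el (case p of (x, L) \<Rightarrow> append_last R x L),
        restrict (case p of (x, L) \<Rightarrow> append_last R x L)
          (R - {lst_el (case p of (x, L) \<Rightarrow> append_last R x L)})) = p"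
      by simp
  qed
  also have "\<dots> = (\<Sum>(x, L)\<in>?T. ext_weight (R - {x}) \<omega> z L)"
    by (intro sum.cong) (auto simp: wt)
  also have "\<dots> = (\<Sum>x\<in>maxs r z R. \<Sum>L\<in>?E (R - {x}) k. ext_weight (R - {x}) \<omega> z L)"
    using fin finm by (intro sum.Sigma[symmetric]) (auto intro: finite_linear_extensions_at)
  finally show ?thesis by (simp add: N_weighted_def)
qed

section \<open>Exchanging adjacent positions\<close>

definition swap_adjacent :: "'a set \<Rightarrow> nat \<Rightarrow> ('a \<Rightarrow> nat) \<Rightarrow> 'a \<Rightarrow> nat" where
  "swap_adjacent R m L = (\<lambda>y\<in>R. if L y = m then Suc m else if L y = Suc m then m else L y)"

lemma swap_adjacent_swap:
  assumes "L \<in> extensional R"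
  shows "swap_adjacent R m (swap_adjacent R m L) = L"
proof
  fix y show "swap_adjacent R m (swap_adjacent R m L) y = L y"
    using assms by (cases "y \<in> R") (auto simp: swap_adjacent_def extensional_def)
qed

lemma swap_adjacent_in:
  assumes fin: "finite R" and z: "z \<in> R" and L: "L \<in> linear_extensions_at R r z l"
    and m: "1 \<le> m" "m < card R"
    and adj: "\<And>y w. y \<in> R \<Longrightarrow> w \<in> R \<Longrightarrow> L y = m \<Longrightarrow> L w = Suc m \<Longrightarrow> \<not> prec r y w"
    and l': "l' = (if l = m then Suc m else if l = Suc m then m else l)"
  shows "swap_adjacent R m L \<in> linear_extensions_at R r z l'"
proof -
  have L': "inj_on L R" "\<And>x. x \<in> R \<Longrightarrow> 1 \<le> L x \<and> L x \<le> card R"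
    "\<And>x y. x \<in> R \<Longrightarrow> y \<in> R \<Longrightarrow> prec r x y \<Longrightarrow> L x < L y" "L z = l"
    using L fin by (auto simp: linear_extensions_at_iff)
  have "inj_on (swap_adjacent R m L) R"
  proof (rule inj_onI)
    fix y w assume yw: "y \<in> R" "w \<in> R" "swap_adjacent R m L y = swap_adjacent R m L w"
    then have "L y = L w" by (auto simp: swap_adjacent_def split: if_splits)
    then show "y = w" using inj_onD[OF L'(1)] yw by blast
  qed
  moreover have "1 \<le> swap_adjacent R m L y \<and> swap_adjacent R m L y \<le> card R" if "y \<in> R" for y
    using L'(2)[OF that] m that by (auto simp: swap_adjacent_def)
  moreover have "swap_adjacent R m L y < swap_adjacent R m L w"
    if "y \<in> R" "w \<in> R" "prec r y w" for y w
    using L'(3)[OF that] adj[OF that(1,2)] that by (auto simp: swap_adjacent_def)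
  moreover have "swap_adjacent R m L z = l'" using z L'(4) l' by (simp add: swap_adjacent_def)
  moreover have "swap_adjacent R m L \<in> extensional R" by (simp add: swap_adjacent_def)
  ultimately show ?thesis using fin by (simp add: linear_extensions_at_iff)
qed

text \<open>The exchange of positions \<open>m\<close> and \<open>Suc m\<close> is an involution
  that matches the two sets of extensions, because \<open>z\<close> is incomparable to its partner
  in either. The partner passes from above to below \<open>z\<close> and brings the factor
  \<open>s\<close>.\<close>

lemma N_weighted_swap:
  assumes fin: "finite R" and z: "z \<in> R" and m: "1 \<le> m" "m < card R"
    and up: "\<And>L x. L \<in> linear_extensions_at R r z m \<Longrightarrow> x \<in> R \<Longrightarrow> L x = Suc m \<Longrightarrow> \<not> prec r z x"
    and down: "\<And>L x. L \<in> linear_extensions_at R r z (Suc m) \<Longrightarrow> x \<in> R \<Longrightarrow> L x = m \<Longrightarrow> \<not> prec r x z"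
    and weight: "\<And>L x. L \<in> linear_extensions_at R r z m \<Longrightarrow> x \<in> R \<Longrightarrow> L x = Suc m \<Longrightarrow> \<omega> x = s"
  shows "N_weighted R r \<omega> z (Suc m) = s * N_weighted R r \<omega> z m"
proof -
  let ?E = "linear_extensions_at R r z" and ?S = "swap_adjacent R m"
  have ext: "L \<in> extensional R" "inj_on L R" "L z = l" if "L \<in> ?E l" for L l
    using that fin by (auto simp: linear_extensions_at_iff)
  have S_up: "?S L \<in> ?E (Suc m)" if L: "L \<in> ?E m" for L
  proof (rule swap_adjacent_in[OF fin z L m])
    show "\<not> prec r y w" if "y \<in> R" "w \<in> R" "L y = m" "L w = Suc m" for y w
      using up[OF L that(2,4)] inj_onD[OF ext(2)[OF L], of y z] ext(3)[OF L] that z by auto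
  qed simp
  have S_down: "?S L \<in> ?E m" if L: "L \<in> ?E (Suc m)" for L
  proof (rule swap_adjacent_in[OF fin z L m])
    show "\<not> prec r y w" if "y \<in> R" "w \<in> R" "L y = m" "L w = Suc m" for y w
      using down[OF L that(1,3)] inj_onD[OF ext(2)[OF L], of w z] ext(3)[OF L] that z by auto
  qed simp
  have wt: "ext_weight R \<omega> z (?S L) = s * ext_weight R \<omega> z L" if L: "L \<in> ?E m" for L
  proof -
    obtain x where x: "x \<in> R" "L x = Suc m" using linear_extensions_at_surj[OF L, of "Suc m"] m by auto
    have Lz: "L z = m" using ext(3)[OF L] .
    have eq: "y = x" if "y \<in> R" "L y = Suc m" for y
      using inj_onD[OF ext(2)[OF L], of y x] that x by simp
    have "{y \<in> R. ?S L y < ?S L z} = insert x {y \<in> R. L y < L z}"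
    proof (intro set_eqI iffI)
      fix y assume y: "y \<in> {y \<in> R. ?S L y < ?S L z}"
      then show "y \<in> insert x {y \<in> R. L y < L z}"
        using eq[of y] Lz z by (auto simp: swap_adjacent_def split: if_splits)
    next
      fix y assume y: "y \<in> insert x {y \<in> R. L y < L z}"
      then show "y \<in> {y \<in> R. ?S L y < ?S L z}"
        using x Lz z by (auto simp: swap_adjacent_def)
    qed
    then show ?thesis using fin x Lz weight[OF L x] by (simp add: ext_weight_def)
  qed
  have "N_weighted R r \<omega> z (Suc m) = (\<Sum>L\<in>?E m. ext_weight R \<omega> z (?S L))"
    unfolding N_weighted_def
    by (rule sum.reindex_bij_witness[where i = ?S and j = ?S])
      (simp_all add: S_up S_down swap_adjacent_swap[OF ext(1)])
  also have "\<dots> = s * N_weighted R r \<omega> z m"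
    by (simp add: N_weighted_def sum_distrib_left wt)
  finally show ?thesis .
qed

section \<open>Counting bounds on positions, and reversal of the order\<close>

lemma num_below_less:
  assumes fin: "finite X" and L: "L \<in> linear_extensions_at X r z l" and x: "x \<in> X"
  shows "num_below X r x < L x"
proof -
  have L': "inj_on L X" "\<And>y. y \<in> X \<Longrightarrow> 1 \<le> L y" "\<And>y. y \<in> X \<Longrightarrow> prec r y x \<Longrightarrow> L y < L x"
    using L fin x by (auto simp: linear_extensions_at_iff)
  have "num_below X r x \<le> card {1..<L x}" unfolding num_below_def
  proof (rule card_inj_on_le)
    show "inj_on L {y \<in> X. prec r y x}" using L'(1) by (rule inj_on_subset) auto
    show "L ` {y \<in> X. prec r y x} \<subseteq> {1..<L x}" using L' by auto
  qed simp
  then show ?thesis using L'(2)[OF x] by simp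
qed

lemma num_above_le:
  assumes fin: "finite X" and L: "L \<in> linear_extensions_at X r z l" and x: "x \<in> X"
  shows "num_above X r x \<le> card X - L x"
proof -
  have L': "inj_on L X" "\<And>y. y \<in> X \<Longrightarrow> L y \<le> card X" "\<And>y. y \<in> X \<Longrightarrow> prec r x y \<Longrightarrow> L x < L y"
    using L fin x by (auto simp: linear_extensions_at_iff)
  have "num_above X r x \<le> card {L x<..card X}" unfolding num_above_def
  proof (rule card_inj_on_le)
    show "inj_on L {y \<in> X. prec r x y}" using L'(1) by (rule inj_on_subset) auto
    show "L ` {y \<in> X. prec r x y} \<subseteq> {L x<..card X}" using L' by auto
  qed simp
  then show ?thesis by simp
qed

lemma prec_converse: "prec (r\<inverse>) x y \<longleftrightarrow> prec r y x"
  by (auto simp: prec_def)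

text \<open>Reflecting the positions exchanges the roles of \<open>num_below\<close> and
  \<open>num_above\<close>, so a result about elements above \<open>z\<close> transfers to those
  below it.\<close>

lemma reverse_extension:
  assumes fin: "finite R" and z: "z \<in> R" and L: "L \<in> linear_extensions_at R r z k"
  shows "(\<lambda>y\<in>R. card R + 1 - L y) \<in> linear_extensions_at R (r\<inverse>) z (card R + 1 - k)"
proof -
  have L': "inj_on L R" "\<And>x. x \<in> R \<Longrightarrow> 1 \<le> L x \<and> L x \<le> card R"
    "\<And>x y. x \<in> R \<Longrightarrow> y \<in> R \<Longrightarrow> prec r x y \<Longrightarrow> L x < L y" "L z = k"
    using L fin by (auto simp: linear_extensions_at_iff)
  have "inj_on (\<lambda>y\<in>R. card R + 1 - L y) R"
  proof (rule inj_onI)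
    fix y w assume yw: "y \<in> R" "w \<in> R"
      "(\<lambda>y\<in>R. card R + 1 - L y) y = (\<lambda>y\<in>R. card R + 1 - L y) w"
    then have "card R + 1 - L y = card R + 1 - L w" by simp
    then have "L y = L w" using L'(2)[OF yw(1)] L'(2)[OF yw(2)] by linarith
    then show "y = w" using inj_onD[OF L'(1)] yw by blast
  qed
  moreover have "card R + 1 - L y < card R + 1 - L w" if "y \<in> R" "w \<in> R" "prec r w y" for y w
    using L'(3)[of w y] L'(2)[of y] that by simp
  moreover have "1 \<le> card R + 1 - L y \<and> card R + 1 - L y \<le> card R" if "y \<in> R" for y
    using L'(2)[OF that] by linarith
  ultimately show ?thesis using fin z L'(4)
    by (simp add: linear_extensions_at_iff prec_converse)
qed

section \<open>The matrices of the atlas\<close>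

locale weighted_poset =
  fixes X :: "'a set" and r :: "'a rel" and \<omega> :: "'a \<Rightarrow> real" and z :: 'a
  assumes finite_X: "finite X"
    and partial_order: "partial_order_on X r"
    and weight_pos: "x \<in> X \<Longrightarrow> \<omega> x > 0"
    and weight_antimono: "x \<in> X \<Longrightarrow> y \<in> X \<Longrightarrow> (x, y) \<in> r \<Longrightarrow> \<omega> x \<ge> \<omega> y"
begin

abbreviation prec_syntax (infix "\<sqsubset>" 50) where "x \<sqsubset> y \<equiv> prec r x y"

lemma prec_irrefl: "\<not> x \<sqsubset> x"
  by (simp add: prec_def)

lemma prec_trans: "x \<sqsubset> y \<Longrightarrow> y \<sqsubset> w \<Longrightarrow> x \<sqsubset> w"
  using partial_order unfolding prec_def partial_order_on_def preorder_on_def trans_def antisym_def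
  by blast

lemma prec_asym: "x \<sqsubset> y \<Longrightarrow> \<not> y \<sqsubset> x"
  using prec_trans prec_irrefl by blast

definition good :: "'a set \<Rightarrow> bool" where
  "good R \<longleftrightarrow> R \<subseteq> X \<and> z \<in> R"

text \<open>Indexed by the number of elements below \<open>z\<close>, which is one less than its
  position.\<close>

definition F :: "'a set \<Rightarrow> nat \<Rightarrow> real" where
  "F R a = N_weighted R r \<omega> z (Suc a)"

text \<open>
  A move \<open>(x, True)\<close> removes a minimal element and appends it below \<open>z\<close>; a move
  \<open>(x, False)\<close> removes a maximal element and puts it above \<open>z\<close>.
\<close>

definition moves :: "'a set \<Rightarrow> ('a \<times> bool) set" where
  "moves R = (\<lambda>x. (x, True)) ` mins r z R \<union> (\<lambda>x. (x, False)) ` maxs r z R"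

definition wt :: "'a \<times> bool \<Rightarrow> real" where
  "wt i = (if snd i then \<omega> (fst i) else 1)"

abbreviation del :: "'a set \<Rightarrow> 'a \<times> bool \<Rightarrow> 'a set" where
  "del R i \<equiv> R - {fst i}"

lemma moves_iff:
  "i \<in> moves R \<longleftrightarrow> fst i \<in> R \<and> fst i \<noteq> z \<and>
    (if snd i then \<forall>y\<in>R. \<not> y \<sqsubset> fst i else \<forall>y\<in>R. \<not> fst i \<sqsubset> y)"
  by (cases i) (auto simp: moves_def mins_def maxs_def)

lemma finite_good: "good R \<Longrightarrow> finite R"
  using finite_X finite_subset by (auto simp: good_def)

lemma finite_moves: "good R \<Longrightarrow> finite (moves R)"
  using finite_good[of R] by (simp add: moves_def mins_def maxs_def)

lemma good_del: "good R \<Longrightarrow> i \<in> moves R \<Longrightarrow> good (del R i)"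
  by (auto simp: good_def moves_iff)

lemma card_del: "good R \<Longrightarrow> i \<in> moves R \<Longrightarrow> card (del R i) = card R - 1"
  using finite_good[of R] by (auto simp: moves_iff)

lemma wt_pos: "good R \<Longrightarrow> i \<in> moves R \<Longrightarrow> wt i > 0"
  using weight_pos by (auto simp: good_def moves_iff wt_def)

lemma F_nonneg: "good R \<Longrightarrow> F R a \<ge> 0"
  unfolding F_def using weight_pos by (intro N_weighted_nonneg) (auto simp: good_def)

lemma moves_del: "j \<in> moves R \<Longrightarrow> fst j \<noteq> fst i \<Longrightarrow> j \<in> moves (del R i)"
  by (auto simp: moves_iff)

text \<open>A released element was blocked by the removed one alone, and hence on the side of that
  removal. This is why vectors that are constant on each side are unchanged by transport to a
  smaller set.\<close>

lemma new_move:
  assumes "i \<in> moves R" "j \<in> moves (del R i)" "j \<notin> moves R"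
  shows "snd j = snd i" "if snd i then fst i \<sqsubset> fst j else fst j \<sqsubset> fst i"
  using assms by (auto simp: moves_iff split: if_splits)

lemma sum_moves:
  "good R \<Longrightarrow> (\<Sum>i\<in>moves R. f i) = (\<Sum>x\<in>mins r z R. f (x, True)) + (\<Sum>x\<in>maxs r z R. f (x, False))"
  unfolding moves_def using finite_good[of R]
  by (subst sum.union_disjoint) (auto simp: mins_def maxs_def sum.reindex inj_on_def)

text \<open>These vectors form the plane spanned by p = \<open>side 1 0\<close> and q =
  \<open>side 0 1\<close>.\<close>

definition side :: "real \<Rightarrow> real \<Rightarrow> 'a \<times> bool \<Rightarrow> real" where
  "side \<alpha> \<beta> i = (if snd i then \<alpha> else \<beta>)"

text \<open>On \<open>side\<close> vectors it combines the recurrences for \<open>F\<close> by the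
  first and by the last element; on general vectors it is the shape of a matrix row one removal
  earlier.\<close>

definition lin :: "'a set \<Rightarrow> nat \<Rightarrow> ('a \<times> bool \<Rightarrow> real) \<Rightarrow> real" where
  "lin R a v = (\<Sum>i\<in>moves R. wt i * v i * F (del R i) a)"

lemma lin_side:
  assumes "good R" "a + 2 \<le> card R"
  shows "lin R a (side \<alpha> \<beta>) = \<alpha> * F R (Suc a) + \<beta> * F R a"
proof -
  have "z \<in> R" using assms by (simp add: good_def)
  then have "F R (Suc a) = (\<Sum>x\<in>mins r z R. \<omega> x * F (R - {x}) a)"
    "F R a = (\<Sum>x\<in>maxs r z R. F (R - {x}) a)"
    unfolding F_def using assms finite_good by (auto intro: N_weighted_mins N_weighted_maxs)
  then show ?thesis
    by (simp add: lin_def sum_moves assms side_def wt_def sum_distrib_left algebra_simps)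
qed

lemma lin_cong: "(\<And>i. i \<in> moves R \<Longrightarrow> v i = v' i) \<Longrightarrow> lin R a v = lin R a v'"
  unfolding lin_def by (rule sum.cong) auto

text \<open>
  A move that becomes available only after the move \<open>i\<close> inherits the coordinate of \<open>i\<close>.
\<close>

definition tr :: "'a set \<Rightarrow> 'a \<times> bool \<Rightarrow> ('a \<times> bool \<Rightarrow> real) \<Rightarrow> 'a \<times> bool \<Rightarrow> real" where
  "tr R i v j = (if j \<in> moves R then v j else v i)"

text \<open>
  The diagonal is chosen so that a row of the matrix is the linear form \<open>lin\<close> of the smaller set
  at the transported vector, see \<open>mat_row\<close>.  The matrix is used when \<open>R\<close> has \<open>a + b + 3\<close>
  elements, for the extensions with \<open>a\<close>, \<open>a + 1\<close> or \<open>a + 2\<close> elements below \<open>z\<close>.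
\<close>

definition mat :: "'a set \<Rightarrow> nat \<Rightarrow> 'a \<times> bool \<Rightarrow> 'a \<times> bool \<Rightarrow> real" where
  "mat R a i j =
    (if i = j then \<Sum>k\<in>moves (del R i) - moves R. wt i * wt k * F (del (del R i) k) a
     else if fst i = fst j then 0
     else wt i * wt j * F (del (del R i) j) a)"

abbreviation B :: "'a set \<Rightarrow> nat \<Rightarrow> ('a \<times> bool \<Rightarrow> real) \<Rightarrow> ('a \<times> bool \<Rightarrow> real) \<Rightarrow> real" where
  "B R a \<equiv> bform (moves R) (mat R a)"

lemma del_commute: "del (del R i) j = del (del R j) i"
  by auto

lemma mat_sym: "mat R a i j = mat R a j i"
  by (simp add: mat_def del_commute[of R i j])

lemma mat_nonneg:
  assumes "good R" "i \<in> moves R" "j \<in> moves R"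
  shows "mat R a i j \<ge> 0"
proof -
  have "wt i * wt k * F (del (del R i) k) a \<ge> 0" if "k \<in> moves (del R i)" for k
    using assms that wt_pos[of R i] wt_pos[of "del R i" k] F_nonneg[of "del (del R i) k"]
    by (simp add: good_del less_imp_le)
  moreover have "j \<in> moves (del R i)" if "fst i \<noteq> fst j"
    using assms that by (simp add: moves_del)
  ultimately show ?thesis by (auto simp: mat_def intro!: sum_nonneg)
qed

lemma mat_row:
  assumes R: "good R" and i: "i \<in> moves R"
  shows "(\<Sum>j\<in>moves R. mat R a i j * v j) = wt i * lin (del R i) a (tr R i v)"
proof -
  let ?f = "\<lambda>j. wt i * wt j * F (del (del R i) j) a"
  let ?J = "{j \<in> moves R. fst j \<noteq> fst i}" and ?N = "moves (del R i) - moves R"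
  have fin: "finite (moves R)" "finite (moves (del R i))"
    using R i by (simp_all add: finite_moves good_del)
  \<comment> \<open>The moves of the smaller set are the surviving moves of \<open>R\<close> and the
    released ones. The latter read the coordinate \<open>v i\<close>, so together they make up the
    diagonal entry.\<close>
  have split: "moves (del R i) = ?J \<union> ?N"
    using moves_del[of _ R i] by (auto simp: moves_iff)
  have "(\<Sum>j\<in>moves R. mat R a i j * v j) = (\<Sum>j\<in>insert i ?J. mat R a i j * v j)"
  proof (rule sum.mono_neutral_right[OF fin(1)])
    show "\<forall>j\<in>moves R - insert i ?J. mat R a i j * v j = 0"
    proof
      fix j assume "j \<in> moves R - insert i ?J"
      then have "fst i = fst j" "i \<noteq> j" by auto
      then show "mat R a i j * v j = 0" by (simp add: mat_def)
    qed
  qed (use i in auto)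
  also have "\<dots> = mat R a i i * v i + (\<Sum>j\<in>?J. mat R a i j * v j)"
    using fin by (intro sum.insert) auto
  also have "(\<Sum>j\<in>?J. mat R a i j * v j) = (\<Sum>j\<in>?J. ?f j * tr R i v j)"
    by (intro sum.cong refl) (clarsimp simp: mat_def tr_def)
  also have "mat R a i i * v i = (\<Sum>j\<in>?N. ?f j * tr R i v j)"
    by (simp add: mat_def tr_def sum_distrib_right)
  also have "(\<Sum>j\<in>?N. ?f j * tr R i v j) + (\<Sum>j\<in>?J. ?f j * tr R i v j)
      = (\<Sum>j\<in>moves (del R i). ?f j * tr R i v j)"
    using fin by (subst (2) split, subst sum.union_disjoint) auto
  also have "\<dots> = wt i * lin (del R i) a (tr R i v)"
    by (simp add: lin_def sum_distrib_left algebra_simps)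
  finally show ?thesis .
qed

lemma B_expand:
  "good R \<Longrightarrow> B R a u v = (\<Sum>i\<in>moves R. wt i * u i * lin (del R i) a (tr R i v))"
  unfolding bform_def by (intro sum.cong) (auto simp: mat_row)

lemma B_sym: "B R a u v = B R a v u"
  by (rule bform_sym) (simp add: mat_sym)

lemma tr_side:
  assumes "i \<in> moves R" "j \<in> moves (del R i)"
  shows "tr R i (side \<alpha> \<beta>) j = side \<alpha> \<beta> j"
  using new_move(1)[OF assms] by (auto simp: tr_def side_def)

text \<open>Transport keeps \<open>side \<alpha> \<beta>\<close>, so the recurrences evaluate every
  row. With \<open>lin_side\<close> the form on the plane of p and q is then expressed by the counts
  at levels \<open>a\<close>, \<open>a + 1\<close> and \<open>a + 2\<close>.\<close>

lemma B_side:
  assumes R: "good R" and card: "a + 3 \<le> card R"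
  shows "B R a v (side \<alpha> \<beta>) = \<alpha> * lin R (Suc a) v + \<beta> * lin R a v"
proof -
  have "B R a v (side \<alpha> \<beta>) = (\<Sum>i\<in>moves R. wt i * v i * lin (del R i) a (side \<alpha> \<beta>))"
    unfolding B_expand[OF R] using R
    by (intro sum.cong arg_cong2[where f = "(*)"] refl lin_cong tr_side)
  also have "\<dots> = (\<Sum>i\<in>moves R. wt i * v i *
      (\<alpha> * F (del R i) (Suc a) + \<beta> * F (del R i) a))"
  proof (intro sum.cong arg_cong2[where f = "(*)"] refl lin_side)
    fix i assume "i \<in> moves R"
    then show "good (del R i)" "a + 2 \<le> card (del R i)"
      using R card by (simp_all add: good_del card_del)
  qed
  also have "\<dots> = \<alpha> * lin R (Suc a) v + \<beta> * lin R a v"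
    by (simp add: lin_def sum_distrib_left sum.distrib algebra_simps)
  finally show ?thesis .
qed

lemma B_side_side:
  assumes R: "good R" and card: "a + 3 \<le> card R"
  shows "B R a (side \<alpha> \<beta>) (side \<gamma> \<delta>) =
    \<alpha> * \<gamma> * F R (Suc (Suc a)) + (\<alpha> * \<delta> + \<beta> * \<gamma>) * F R (Suc a) + \<beta> * \<delta> * F R a"
  using R card by (simp add: B_side lin_side algebra_simps)

text \<open>By \<open>B_side\<close>, this is the combination whose rows are values of the smaller
  form against \<open>side \<alpha> \<beta>\<close>, a vector that is positive when both
  coefficients are.\<close>

definition mat2 :: "'a set \<Rightarrow> nat \<Rightarrow> real \<Rightarrow> real \<Rightarrow> 'a \<times> bool \<Rightarrow> 'a \<times> bool \<Rightarrow> real" where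
  "mat2 R a \<alpha> \<beta> i j = \<alpha> * mat R (Suc a) i j + \<beta> * mat R a i j"

lemma mat2_row:
  assumes R: "good R" and i: "i \<in> moves R" and card: "a + 4 \<le> card R"
  shows "(\<Sum>j\<in>moves R. mat2 R a \<alpha> \<beta> i j * v j) = wt i * B (del R i) a (tr R i v) (side \<alpha> \<beta>)"
proof -
  have "(\<Sum>j\<in>moves R. mat2 R a \<alpha> \<beta> i j * v j) =
    \<alpha> * (\<Sum>j\<in>moves R. mat R (Suc a) i j * v j) + \<beta> * (\<Sum>j\<in>moves R. mat R a i j * v j)"
    by (simp add: mat2_def sum_distrib_left sum.distrib algebra_simps)
  also have "\<dots> = wt i * (\<alpha> * lin (del R i) (Suc a) (tr R i v) + \<beta> * lin (del R i) a (tr R i v))"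
    unfolding mat_row[OF R i] by (simp add: algebra_simps)
  also have "\<dots> = wt i * B (del R i) a (tr R i v) (side \<alpha> \<beta>)"
    using R i card by (simp add: B_side good_del card_del)
  finally show ?thesis .
qed

lemma bform_mat2: "bform (moves R) (mat2 R a \<alpha> \<beta>) u v = \<alpha> * B R (Suc a) u v + \<beta> * B R a u v"
  by (simp add: bform_def mat2_def sum_distrib_left sum.distrib algebra_simps)

text \<open>The two orders of transport agree at \<open>k\<close> unless \<open>k\<close> needs both
  removals. Then \<open>k\<close>, \<open>i\<close> and \<open>j\<close> lie on one side, the
  transported coordinates are \<open>v j\<close> and \<open>v i\<close>, and the product is a square
  times a nonnegative coefficient.\<close>

lemma pull_pointwise:
  assumes i: "i \<in> moves R" and j: "j \<in> moves R" and ne: "fst i \<noteq> fst j"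
    and k: "k \<in> moves (del (del R i) j)" and nonneg: "\<alpha> \<ge> 0" "\<beta> \<ge> 0"
  shows "(side \<alpha> \<beta> i * v j - v i * side \<alpha> \<beta> j) *
    (tr (del R i) j (tr R i v) k - tr (del R j) i (tr R j v) k) \<ge> 0"
proof -
  have ij: "i \<in> moves (del R j)" "j \<in> moves (del R i)"
    using i j ne by (auto intro: moves_del)
  have k': "k \<in> moves (del (del R j) i)" using k by (simp add: del_commute)
  have ne_ij: "fst i \<in> R" "fst j \<in> R" using i j by (auto simp: moves_iff)
  consider "k \<in> moves R" | "k \<notin> moves R" "k \<in> moves (del R i)" | "k \<notin> moves R" "k \<in> moves (del R j)"
    | "k \<notin> moves (del R i)" "k \<notin> moves (del R j)" by blast
  then show ?thesis
  proof cases
    case 1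
    then have "k \<in> moves (del R i)" "k \<in> moves (del R j)"
      using k moves_del[of k R] by (auto simp: moves_iff)
    with 1 show ?thesis by (simp add: tr_def)
  next
    case 2
    \<comment> \<open>In \<open>R\<close> the element of \<open>k\<close> is blocked by
      \<open>fst i\<close>, which is still present in \<open>del R j\<close>.\<close>
    have "k \<notin> moves (del R j)"
      using new_move[OF i 2(2,1)] ne ne_ij by (auto simp: moves_iff split: if_splits)
    with 2 show ?thesis using i j by (simp add: tr_def)
  next
    case 3
    have "k \<notin> moves (del R i)"
      using new_move[OF j 3(2,1)] ne ne_ij by (auto simp: moves_iff split: if_splits)
    with 3 show ?thesis using i j by (simp add: tr_def)
  next
    case 4
    have "snd k = snd i" "snd k = snd j"
      using new_move(1)[OF ij(2) k 4(1)] new_move(1)[OF ij(1) k' 4(2)] by auto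
    then have s: "side \<alpha> \<beta> i = side \<alpha> \<beta> j" "side \<alpha> \<beta> j \<ge> 0" using nonneg by (auto simp: side_def)
    have "(side \<alpha> \<beta> i * v j - v i * side \<alpha> \<beta> j) *
        (tr (del R i) j (tr R i v) k - tr (del R j) i (tr R j v) k)
        = side \<alpha> \<beta> j * (v j - v i)\<^sup>2"
      using 4 i j by (simp add: tr_def s power2_eq_square algebra_simps)
    then show ?thesis using s by simp
  qed
qed

text \<open>
  Expanding both sides over words of three moves, only words whose first two moves \<open>i\<close>, \<open>j\<close> are
  both available in \<open>R\<close> contribute to the difference; exchanging \<open>i\<close> and \<open>j\<close> then leaves
  squares \<open>(v j - v i)\<^sup>2\<close>, one for each third move that needs both \<open>i\<close> and \<open>j\<close>.
\<close>

lemma pull: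
  assumes R: "good R" and card: "a + 4 \<le> card R" and nonneg: "\<alpha> \<ge> 0" "\<beta> \<ge> 0"
  shows "bform (moves R) (mat2 R a \<alpha> \<beta>) v v \<le>
    (\<Sum>i\<in>moves R. wt i * side \<alpha> \<beta> i * B (del R i) a (tr R i v) (tr R i v))"
proof -
  let ?s = "side \<alpha> \<beta>"
  define Lam where "Lam i j = lin (del (del R i) j) a (tr (del R i) j (tr R i v))" for i j
  define G where "G i j = (if fst i = fst j then 0
    else wt i * wt j * ((?s i * v j - v i * ?s j) * Lam i j))" for i j
  have B: "B (del R i) a u (tr R i v) = (\<Sum>j\<in>moves (del R i). wt j * u j * Lam i j)"
    if "i \<in> moves R" for i u
    using R that by (simp add: B_expand good_del Lam_def)
  have "bform (moves R) (mat2 R a \<alpha> \<beta>) v v =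
      (\<Sum>i\<in>moves R. wt i * v i * B (del R i) a ?s (tr R i v))"
    unfolding bform_def[of "moves R"]
  proof (rule sum.cong[OF refl])
    fix i assume "i \<in> moves R"
    from mat2_row[OF R this card] B_sym[of "del R i" a "tr R i v" ?s]
    show "v i * (\<Sum>j\<in>moves R. mat2 R a \<alpha> \<beta> i j * v j)
        = wt i * v i * B (del R i) a ?s (tr R i v)" by simp
  qed
  then have "(\<Sum>i\<in>moves R. wt i * ?s i * B (del R i) a (tr R i v) (tr R i v))
      - bform (moves R) (mat2 R a \<alpha> \<beta>) v v
    = (\<Sum>i\<in>moves R. wt i * (?s i * B (del R i) a (tr R i v) (tr R i v)
        - v i * B (del R i) a ?s (tr R i v)))"
    by (simp add: sum_subtractf algebra_simps)
  also have "\<dots> = (\<Sum>i\<in>moves R. \<Sum>j\<in>moves R. G i j)"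
  proof (rule sum.cong[OF refl])
    fix i assume i: "i \<in> moves R"
    have fin: "finite (moves R)" "finite (moves (del R i))"
      using R i by (simp_all add: finite_moves good_del)
    have "wt i * (?s i * B (del R i) a (tr R i v) (tr R i v) - v i * B (del R i) a ?s (tr R i v))
      = (\<Sum>j\<in>moves (del R i). wt i * wt j * ((?s i * tr R i v j - v i * ?s j) * Lam i j))"
      unfolding B[OF i] by (simp add: sum_distrib_left sum_subtractf algebra_simps)
    \<comment> \<open>A move released by \<open>i\<close> lies on the side of \<open>i\<close> and
      inherits its coordinate, so the bracket is 0 there.\<close>
    also have "\<dots> = (\<Sum>j\<in>{j \<in> moves R. fst j \<noteq> fst i}.
        wt i * wt j * ((?s i * tr R i v j - v i * ?s j) * Lam i j))"
    proof (rule sum.mono_neutral_right[OF fin(2)])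
      show "{j \<in> moves R. fst j \<noteq> fst i} \<subseteq> moves (del R i)" using moves_del by blast
      show "\<forall>j\<in>moves (del R i) - {j \<in> moves R. fst j \<noteq> fst i}.
          wt i * wt j * ((?s i * tr R i v j - v i * ?s j) * Lam i j) = 0"
      proof
        fix j assume j: "j \<in> moves (del R i) - {j \<in> moves R. fst j \<noteq> fst i}"
        then have "j \<notin> moves R" by (auto simp: moves_iff)
        with j have "snd j = snd i" "tr R i v j = v i" using new_move(1)[OF i] by (auto simp: tr_def)
        then show "wt i * wt j * ((?s i * tr R i v j - v i * ?s j) * Lam i j) = 0"
          by (simp add: side_def)
      qed
    qed
    also have "\<dots> = (\<Sum>j\<in>{j \<in> moves R. fst j \<noteq> fst i}. G i j)"
      by (intro sum.cong) (auto simp: G_def tr_def)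
    also have "\<dots> = (\<Sum>j\<in>moves R. G i j)"
      using fin by (intro sum.mono_neutral_left) (auto simp: G_def)
    finally show "wt i * (?s i * B (del R i) a (tr R i v) (tr R i v)
      - v i * B (del R i) a ?s (tr R i v)) = (\<Sum>j\<in>moves R. G i j)" .
  qed
  also have "\<dots> \<ge> 0"
  proof (rule double_sum_antisym)
    fix i j assume i: "i \<in> moves R" and j: "j \<in> moves R"
    show "G i j + G j i \<ge> 0"
    proof (cases "fst i = fst j")
      case False
      let ?c = "?s i * v j - v i * ?s j"
      let ?d = "\<lambda>k. tr (del R i) j (tr R i v) k - tr (del R j) i (tr R j v) k"
      have R': "good (del (del R i) j)" using R i j False by (intro good_del moves_del) auto
      have "Lam i j - Lam j i = (\<Sum>k\<in>moves (del (del R i) j). wt k * ?d k * F (del (del (del R i) j) k) a)"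
        unfolding Lam_def lin_def del_commute[of R j i]
        by (simp add: sum_subtractf algebra_simps)
      then have "?c * (Lam i j - Lam j i) = (\<Sum>k\<in>moves (del (del R i) j).
          wt k * (?c * ?d k) * F (del (del (del R i) j) k) a)"
        by (simp add: sum_distrib_left algebra_simps)
      also have "\<dots> \<ge> 0"
      proof (rule sum_nonneg)
        fix k assume k: "k \<in> moves (del (del R i) j)"
        show "0 \<le> wt k * (?c * ?d k) * F (del (del (del R i) j) k) a"
          by (rule mult_nonneg_nonneg[OF mult_nonneg_nonneg[OF less_imp_le[OF wt_pos[OF R' k]]
                pull_pointwise[OF i j False k nonneg]] F_nonneg[OF good_del[OF R' k]]])
      qed
      finally have "wt i * wt j * (?c * (Lam i j - Lam j i)) \<ge> 0"
        using wt_pos[OF R i] wt_pos[OF R j] by simp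
      moreover have "G i j + G j i = wt i * wt j * (?c * (Lam i j - Lam j i))"
        using False by (simp add: G_def algebra_simps)
      ultimately show ?thesis by simp
    qed (simp add: G_def)
  qed
  finally show ?thesis by simp
qed

subsection \<open>Positivity\<close>

lemma exists_minimal:
  assumes "finite S" "S \<noteq> {}"
  obtains m where "m \<in> S" "\<And>y. y \<in> S \<Longrightarrow> \<not> y \<sqsubset> m"
proof -
  obtain m where m: "m \<in> S" "\<And>y. y \<in> S \<Longrightarrow> card {w \<in> S. w \<sqsubset> m} \<le> card {w \<in> S. w \<sqsubset> y}"
    using ex_is_arg_min_if_finite[OF assms, of "\<lambda>x. card {w \<in> S. w \<sqsubset> x}"]
    by (auto simp: is_arg_min_def not_less)
  have "\<not> y \<sqsubset> m" if "y \<in> S" for y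
  proof
    assume "y \<sqsubset> m"
    then have "{w \<in> S. w \<sqsubset> y} \<subset> {w \<in> S. w \<sqsubset> m}"
      using that prec_trans prec_irrefl by blast
    then have "card {w \<in> S. w \<sqsubset> y} < card {w \<in> S. w \<sqsubset> m}"
      using assms by (intro psubset_card_mono) auto
    with m(2)[OF that] show False by simp
  qed
  with m(1) that show ?thesis by blast
qed

lemma exists_maximal:
  assumes "finite S" "S \<noteq> {}"
  obtains m where "m \<in> S" "\<And>y. y \<in> S \<Longrightarrow> \<not> m \<sqsubset> y"
proof -
  obtain m where m: "m \<in> S" "\<And>y. y \<in> S \<Longrightarrow> card {w \<in> S. m \<sqsubset> w} \<le> card {w \<in> S. y \<sqsubset> w}"
    using ex_is_arg_min_if_finite[OF assms, of "\<lambda>x. card {w \<in> S. x \<sqsubset> w}"]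
    by (auto simp: is_arg_min_def not_less)
  have "\<not> m \<sqsubset> y" if "y \<in> S" for y
  proof
    assume "m \<sqsubset> y"
    then have "{w \<in> S. y \<sqsubset> w} \<subset> {w \<in> S. m \<sqsubset> w}"
      using that prec_trans prec_irrefl by blast
    then have "card {w \<in> S. y \<sqsubset> w} < card {w \<in> S. m \<sqsubset> w}"
      using assms by (intro psubset_card_mono) auto
    with m(2)[OF that] show False by simp
  qed
  with m(1) that show ?thesis by blast
qed

definition below :: "'a set \<Rightarrow> nat" where
  "below R = card {x \<in> R. x \<sqsubset> z}"

definition above :: "'a set \<Rightarrow> nat" where
  "above R = card {x \<in> R. z \<sqsubset> x}"

lemma below_remove:
  assumes "good R" "x \<in> R"
  shows "below R = below (R - {x}) + (if x \<sqsubset> z then 1 else 0)"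
proof -
  have "{y \<in> R. y \<sqsubset> z} = (if x \<sqsubset> z then insert x else id) {y \<in> R - {x}. y \<sqsubset> z}"
    using assms by auto
  then show ?thesis unfolding below_def using finite_good[OF assms(1)] by auto
qed

lemma above_remove:
  assumes "good R" "x \<in> R"
  shows "above R = above (R - {x}) + (if z \<sqsubset> x then 1 else 0)"
proof -
  have "{y \<in> R. z \<sqsubset> y} = (if z \<sqsubset> x then insert x else id) {y \<in> R - {x}. z \<sqsubset> y}"
    using assms by auto
  then show ?thesis unfolding above_def using finite_good[OF assms(1)] by auto
qed

lemma below_above_le:
  assumes "good R"
  shows "below R + above R + 1 \<le> card R"
proof -
  let ?A = "{x \<in> R. x \<sqsubset> z}" and ?C = "{x \<in> R. z \<sqsubset> x}"
  have fin: "finite R" using assms by (rule finite_good)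
  have "card (?A \<union> ?C) = below R + above R"
    unfolding below_def above_def using fin prec_asym by (intro card_Un_disjoint) auto
  moreover have "card (insert z (?A \<union> ?C)) = Suc (card (?A \<union> ?C))"
    using fin prec_irrefl by (intro card_insert_disjoint) auto
  moreover have "card (insert z (?A \<union> ?C)) \<le> card R"
    using assms fin by (intro card_mono) (auto simp: good_def)
  ultimately show ?thesis by simp
qed

lemma F_singleton: "F {z} 0 = 1"
proof -
  have "linear_extensions_at {z} r z (Suc 0) = {\<lambda>x\<in>{z}. Suc 0}"
    by (auto simp: linear_extensions_at_iff prec_irrefl extensional_def)
  then show ?thesis by (simp add: F_def N_weighted_def ext_weight_def cong: conj_cong)
qed

lemma F_mins: "good R \<Longrightarrow> F R (Suc a) = (\<Sum>x\<in>mins r z R. \<omega> x * F (R - {x}) a)"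
  unfolding F_def using finite_good by (intro N_weighted_mins) (auto simp: good_def)

lemma F_maxs: "good R \<Longrightarrow> Suc a < card R \<Longrightarrow> F R a = (\<Sum>x\<in>maxs r z R. F (R - {x}) a)"
  unfolding F_def using finite_good by (intro N_weighted_maxs) (auto simp: good_def)

lemma finite_mins: "good R \<Longrightarrow> finite (mins r z R)"
  and finite_maxs: "good R \<Longrightarrow> finite (maxs r z R)"
  by (simp_all add: finite_good mins_def maxs_def)

lemma good_remove: "good R \<Longrightarrow> x \<noteq> z \<Longrightarrow> good (R - {x})"
  by (auto simp: good_def)

text \<open>The element removed is a minimal predecessor of \<open>z\<close> if there is one, and
  otherwise a minimal element among those not above \<open>z\<close>. The latter exist because
  \<open>z\<close> and its successors number at most \<open>b + 1\<close>.\<close>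

lemma exists_move_down:
  assumes R: "good R" and card: "card R = a + b + 2" and le: "below R \<le> Suc a" "above R \<le> b"
  obtains x where "x \<in> mins r z R" "below (R - {x}) \<le> a" "above (R - {x}) \<le> b"
proof (cases "below R = 0")
  case True
  have fin: "finite R" using R by (rule finite_good)
  have "card (insert z {x \<in> R. z \<sqsubset> x}) \<le> Suc b"
    using le fin by (simp add: above_def card_insert_if)
  then have "card (insert z {x \<in> R. z \<sqsubset> x}) < card R" using card by simp
  then have "R - insert z {x \<in> R. z \<sqsubset> x} \<noteq> {}"
    using card_mono[of "insert z {x \<in> R. z \<sqsubset> x}" R] fin by auto
  with fin obtain x where x: "x \<in> R - insert z {x \<in> R. z \<sqsubset> x}"
    "\<And>y. y \<in> R - insert z {x \<in> R. z \<sqsubset> x} \<Longrightarrow> \<not> y \<sqsubset> x"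
    using exists_minimal[of "R - insert z {x \<in> R. z \<sqsubset> x}"] by blast
  then have "x \<in> mins r z R" using prec_trans by (auto simp: mins_def)
  moreover have "below (R - {x}) \<le> a" "above (R - {x}) \<le> b"
    using below_remove[OF R, of x] above_remove[OF R, of x] x True le by auto
  ultimately show ?thesis by (rule that)
next
  case False
  have fin: "finite R" using R by (rule finite_good)
  have "finite {x \<in> R. x \<sqsubset> z}" using fin by simp
  moreover have "{x \<in> R. x \<sqsubset> z} \<noteq> {}" using False unfolding below_def by (metis card.empty)
  ultimately obtain x where x: "x \<in> {x \<in> R. x \<sqsubset> z}" "\<And>y. y \<in> {x \<in> R. x \<sqsubset> z} \<Longrightarrow> \<not> y \<sqsubset> x"
    by (rule exists_minimal) blast
  then have "x \<in> mins r z R" using prec_trans prec_irrefl by (auto simp: mins_def)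
  moreover have "below (R - {x}) \<le> a" "above (R - {x}) \<le> b"
    using below_remove[OF R, of x] above_remove[OF R, of x] x le by auto
  ultimately show ?thesis by (rule that)
qed

lemma exists_move_up:
  assumes R: "good R" and card: "card R = a + b + 2" and le: "below R \<le> a" "above R \<le> Suc b"
  obtains x where "x \<in> maxs r z R" "below (R - {x}) \<le> a" "above (R - {x}) \<le> b"
proof (cases "above R = 0")
  case True
  have fin: "finite R" using R by (rule finite_good)
  have "card (insert z {x \<in> R. x \<sqsubset> z}) \<le> Suc a"
    using le fin by (simp add: below_def card_insert_if)
  then have "card (insert z {x \<in> R. x \<sqsubset> z}) < card R" using card by simp
  then have "R - insert z {x \<in> R. x \<sqsubset> z} \<noteq> {}"
    using card_mono[of "insert z {x \<in> R. x \<sqsubset> z}" R] fin by auto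
  with fin obtain x where x: "x \<in> R - insert z {x \<in> R. x \<sqsubset> z}"
    "\<And>y. y \<in> R - insert z {x \<in> R. x \<sqsubset> z} \<Longrightarrow> \<not> x \<sqsubset> y"
    using exists_maximal[of "R - insert z {x \<in> R. x \<sqsubset> z}"] by blast
  then have "x \<in> maxs r z R" using prec_trans by (auto simp: maxs_def)
  moreover have "below (R - {x}) \<le> a" "above (R - {x}) \<le> b"
    using below_remove[OF R, of x] above_remove[OF R, of x] x True le by auto
  ultimately show ?thesis by (rule that)
next
  case False
  have fin: "finite R" using R by (rule finite_good)
  have "finite {x \<in> R. z \<sqsubset> x}" using fin by simp
  moreover have "{x \<in> R. z \<sqsubset> x} \<noteq> {}" using False unfolding above_def by (metis card.empty)
  ultimately obtain x where x: "x \<in> {x \<in> R. z \<sqsubset> x}" "\<And>y. y \<in> {x \<in> R. z \<sqsubset> x} \<Longrightarrow> \<not> x \<sqsubset> y"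
    by (rule exists_maximal) blast
  then have "x \<in> maxs r z R" using prec_trans prec_irrefl by (auto simp: maxs_def)
  moreover have "below (R - {x}) \<le> a" "above (R - {x}) \<le> b"
    using below_remove[OF R, of x] above_remove[OF R, of x] x le by auto
  ultimately show ?thesis by (rule that)
qed

text \<open>The two removal lemmas peel \<open>R\<close> down to \<open>z\<close>. Together with
  \<open>F_posD\<close> this decides by two counts whether \<open>F R a\<close> vanishes, which
  makes the zero pattern of the matrices explicit.\<close>

lemma F_pos:
  assumes "good R" "card R = a + b + 1" "below R \<le> a" "above R \<le> b"
  shows "F R a > 0"
  using assms
proof (induction "card R" arbitrary: R a b)
  case (Suc n)
  note R = \<open>good R\<close>
  consider a' where "a = Suc a'" | b' where "a = 0" "b = Suc b'" | "a = 0" "b = 0"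
    by (cases a; cases b) auto
  then show ?case
  proof cases
    case 1
    obtain x where x: "x \<in> mins r z R" "below (R - {x}) \<le> a'" "above (R - {x}) \<le> b"
      using exists_move_down[of R a' b] Suc.prems 1 by auto
    then have xR: "x \<in> R" "x \<noteq> z" "\<omega> x > 0" using R weight_pos by (auto simp: mins_def good_def)
    have "F (R - {x}) a' > 0"
      using Suc.hyps(1)[of "R - {x}" a' b] Suc.hyps(2) Suc.prems x xR 1 finite_good[OF R]
      by (simp add: good_remove)
    then show ?thesis unfolding 1 F_mins[OF R]
      using x xR R weight_pos
      by (intro sum_pos2[OF finite_mins[OF R] x(1)] mult_pos_pos mult_nonneg_nonneg F_nonneg)
        (auto simp: mins_def good_def less_imp_le)
  next
    case 2
    obtain x where x: "x \<in> maxs r z R" "below (R - {x}) \<le> 0" "above (R - {x}) \<le> b'"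
      using exists_move_up[of R 0 b'] Suc.prems 2 by auto
    then have xR: "x \<in> R" "x \<noteq> z" using R by (auto simp: maxs_def good_def)
    have "F (R - {x}) 0 > 0"
      using Suc.hyps(1)[of "R - {x}" 0 b'] Suc.hyps(2) Suc.prems x xR 2 finite_good[OF R]
      by (simp add: good_remove)
    moreover have "Suc a < card R" using 2 Suc.prems by simp
    ultimately show ?thesis using F_maxs[OF R] 2(1) x xR R
      by (simp, intro sum_pos2[OF finite_maxs[OF R] x(1)] F_nonneg)
        (auto simp: maxs_def good_def)
  next
    case 3
    then have "card R = 1" using Suc.prems by simp
    then have "R = {z}" using R by (auto simp: good_def card_1_singleton_iff)
    then show ?thesis using F_singleton 3 by simp
  qed
qed (use finite_good in auto)

lemma F_posD:
  assumes R: "good R" and card: "card R = a + b + 1" and pos: "F R a > 0"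
  shows "below R \<le> a" "above R \<le> b"
proof -
  have fin: "finite R" using R by (rule finite_good)
  have "linear_extensions_at R r z (Suc a) \<noteq> {}"
    using pos N_weighted_pos_iff[OF fin, of \<omega> r z "Suc a"] R weight_pos by (auto simp: F_def good_def)
  then obtain L where "L \<in> linear_extensions_at R r z (Suc a)" by blast
  then have L: "inj_on L R" "\<And>x. x \<in> R \<Longrightarrow> 1 \<le> L x \<and> L x \<le> card R"
    "\<And>x y. x \<in> R \<Longrightarrow> y \<in> R \<Longrightarrow> x \<sqsubset> y \<Longrightarrow> L x < L y" "L z = Suc a"
    using fin by (auto simp: linear_extensions_at_iff)
  have z: "z \<in> R" using R by (simp add: good_def)
  have "card {x \<in> R. x \<sqsubset> z} \<le> card {1..a}"
  proof (rule card_inj_on_le)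
    show "inj_on L {x \<in> R. x \<sqsubset> z}" using L(1) by (rule inj_on_subset) auto
    show "L ` {x \<in> R. x \<sqsubset> z} \<subseteq> {1..a}" using L(2-4) z by fastforce
  qed simp
  then show "below R \<le> a" by (simp add: below_def)
  have "card {x \<in> R. z \<sqsubset> x} \<le> card {a + 2..card R}"
  proof (rule card_inj_on_le)
    show "inj_on L {x \<in> R. z \<sqsubset> x}" using L(1) by (rule inj_on_subset) auto
    show "L ` {x \<in> R. z \<sqsubset> x} \<subseteq> {a + 2..card R}" using L(2-4) z by fastforce
  qed simp
  then show "above R \<le> b" by (simp add: above_def card)
qed

text \<open>Failure at both levels would force exactly \<open>a + 1\<close> elements below and
  \<open>b + 1\<close> above \<open>z\<close>, too many for a set of \<open>a + b + 2\<close>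
  elements that contains \<open>z\<close>.\<close>

lemma mat2_nonzero:
  assumes R: "good R" and card: "card R = a + b + 4" and coef: "\<alpha> > 0" "\<beta> > 0"
    and i: "i \<in> moves R" and j: "j \<in> moves R" and ne: "fst i \<noteq> fst j"
    and le: "below (del (del R i) j) \<le> Suc a" "above (del (del R i) j) \<le> Suc b"
  shows "mat2 R a \<alpha> \<beta> i j \<noteq> 0"
proof -
  let ?S = "del (del R i) j"
  have j': "j \<in> moves (del R i)" using j ne by (auto intro: moves_del)
  have S: "good ?S" "card ?S = a + b + 2"
    using R i j' card by (simp_all add: good_del card_del)
  have "F ?S (Suc a) > 0 \<or> F ?S a > 0"
  proof (cases "below ?S \<le> a")
    case True
    then show ?thesis using F_pos[of ?S a "Suc b"] S le by simp
  next
    case False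
    then have "above ?S \<le> b" using below_above_le[OF S(1)] S le by simp
    then show ?thesis using F_pos[of ?S "Suc a" b] S le by simp
  qed
  then have "\<alpha> * F ?S (Suc a) + \<beta> * F ?S a > 0"
    using coef F_nonneg[OF S(1)] by (metis add_nonneg_pos add_pos_nonneg less_imp_le mult_nonneg_nonneg mult_pos_pos)
  moreover have "mat2 R a \<alpha> \<beta> i j = wt i * wt j * (\<alpha> * F ?S (Suc a) + \<beta> * F ?S a)"
    using ne by (auto simp: mat2_def mat_def algebra_simps)
  ultimately show ?thesis using wt_pos[OF R i] wt_pos[OF R j] by simp
qed

lemma B_tr_side:
  assumes "good R" "i \<in> moves R"
  shows "B (del R i) a u (tr R i (side \<alpha> \<beta>)) = B (del R i) a u (side \<alpha> \<beta>)"
  using assms tr_side by (intro bform_cong) auto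

lemma row_posD:
  assumes R: "good R" and card: "card R = a + b + 4" and i: "i \<in> moves R"
    and pos: "(\<Sum>k\<in>moves R. mat2 R a \<alpha> \<beta> i k * side \<alpha> \<beta> k) > 0"
  shows "below (del R i) \<le> a + 2" "above (del R i) \<le> b + 2"
proof -
  let ?S = "del R i"
  have S: "good ?S" "card ?S = a + b + 3" using R i card by (simp_all add: good_del card_del)
  have "(\<Sum>k\<in>moves R. mat2 R a \<alpha> \<beta> i k * side \<alpha> \<beta> k) = wt i * B ?S a (side \<alpha> \<beta>) (side \<alpha> \<beta>)"
    using mat2_row[OF R i, of a \<alpha> \<beta> "side \<alpha> \<beta>"] B_tr_side[OF R i] B_sym card by simp
  with pos have "B ?S a (side \<alpha> \<beta>) (side \<alpha> \<beta>) \<noteq> 0" by auto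
  then have "F ?S (Suc (Suc a)) \<noteq> 0 \<or> F ?S (Suc a) \<noteq> 0 \<or> F ?S a \<noteq> 0"
    using B_side_side[OF S(1)] S(2) by auto
  then have "F ?S (Suc (Suc a)) > 0 \<or> F ?S (Suc a) > 0 \<or> F ?S a > 0"
    using F_nonneg[OF S(1)] by (metis less_eq_real_def)
  then show "below ?S \<le> a + 2" "above ?S \<le> b + 2"
    using F_posD[OF S(1), of "Suc (Suc a)" b] F_posD[OF S(1), of "Suc a" "Suc b"]
      F_posD[OF S(1), of a "Suc (Suc b)"] S(2) by auto
qed

subsection \<open>Hyperbolicity\<close>

text \<open>Two moves are joined once their removal leaves at most \<open>a + 1\<close> elements
  below and \<open>b + 1\<close> above \<open>z\<close>. The cases compare the counts of
  \<open>R\<close> with these bounds; they add up to at most \<open>a + b + 3\<close>, so at most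
  one bound is exceeded.\<close>

lemma moves_connected:
  assumes R: "good R" and card: "card R = a + b + 4" and coef: "\<alpha> > 0" "\<beta> > 0"
    and g: "\<And>i j. i \<in> moves R \<Longrightarrow> j \<in> moves R \<Longrightarrow> mat2 R a \<alpha> \<beta> i j \<noteq> 0 \<Longrightarrow> g i = (g j :: real)"
    and i: "i \<in> moves R" "(\<Sum>k\<in>moves R. mat2 R a \<alpha> \<beta> i k * side \<alpha> \<beta> k) > 0"
    and j: "j \<in> moves R" "(\<Sum>k\<in>moves R. mat2 R a \<alpha> \<beta> j k * side \<alpha> \<beta> k) > 0"
  shows "g i = g j"
proof -
  have fin: "finite R" using R by (rule finite_good)
  have adj: "g i = g j" if "i \<in> moves R" "j \<in> moves R" "fst i \<noteq> fst j"
    "below (del (del R i) j) \<le> Suc a" "above (del (del R i) j) \<le> Suc b" for i j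
    using mat2_nonzero[OF R card coef that(1-3)] that g by blast
  have del1: "below R = below (del R i) + (if fst i \<sqsubset> z then 1 else 0)"
    "above R = above (del R i) + (if z \<sqsubset> fst i then 1 else 0)" if "i \<in> moves R" for i
    using that R below_remove above_remove by (auto simp: moves_iff)
  have del2: "below R = below (del (del R i) j) + (if fst i \<sqsubset> z then 1 else 0) + (if fst j \<sqsubset> z then 1 else 0)"
    "above R = above (del (del R i) j) + (if z \<sqsubset> fst i then 1 else 0) + (if z \<sqsubset> fst j then 1 else 0)"
    if "i \<in> moves R" "j \<in> moves R" "fst i \<noteq> fst j" for i j
    using del1[OF that(1)] that good_del[OF R that(1)]
      below_remove[of "del R i" "fst j"] above_remove[of "del R i" "fst j"]
    by (auto simp: moves_iff)
  have tot: "below R + above R + 1 \<le> card R" by (rule below_above_le[OF R])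
  note bi = row_posD[OF R card i] and bj = row_posD[OF R card j]
  have same: "k = k'" if "k \<in> moves R" "k' \<in> moves R" "fst k = fst k'" "fst k \<sqsubset> z \<or> z \<sqsubset> fst k" for k k'
    using that R by (auto simp: moves_iff good_def prod_eq_iff split: if_splits)
  consider "below R \<le> a + 1" "above R \<le> b + 1" | "below R = a + 2" "above R \<le> b + 1"
    | "above R = b + 2" "below R \<le> a + 1" | "below R \<ge> a + 3" | "above R \<ge> b + 3"
    using tot card by linarith
  then show ?thesis
  proof cases
    case 1
    have all: "g k = g k'" if "k \<in> moves R" "k' \<in> moves R" "fst k \<noteq> fst k'" for k k'
      using del2[OF that] 1 by (intro adj that) auto
    show ?thesis
    proof (cases "fst i = fst j \<and> i \<noteq> j")
      case True
      \<comment> \<open>\<open>x\<close> is both minimal and maximal, and its two moves are not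
        joined directly. A removable element other than \<open>x\<close> links them: a maximal one
        if all others are above \<open>z\<close>, else a minimal one among those not above
        \<open>z\<close>.\<close>
      define x where "x = fst i"
      have iso: "\<not> x \<sqsubset> y" "\<not> y \<sqsubset> x" if "y \<in> R" for y
        using True i j that by (auto simp: x_def moves_iff prod_eq_iff split: if_splits)
      have x: "x \<in> R" using i by (simp add: x_def moves_iff)
      have "\<exists>k\<in>moves R. fst k \<noteq> x"
      proof (cases "\<forall>y\<in>R - {x, z}. z \<sqsubset> y")
        case True
        have "card {x, z} \<le> 2" by (simp add: card_insert_if)
        then have "R - {x, z} \<noteq> {}" using card card_mono[of "{x, z}" R] by fastforce
        moreover have "finite (R - {x, z})" using fin by simp
        ultimately obtain m where m: "m \<in> R - {x, z}" "\<And>y. y \<in> R - {x, z} \<Longrightarrow> \<not> m \<sqsubset> y"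
          using exists_maximal by metis
        have "\<not> m \<sqsubset> y" if "y \<in> R" for y
          using m that iso(2) True prec_asym by (cases "y = x \<or> y = z") auto
        then have "(m, False) \<in> moves R" using m by (simp add: moves_iff)
        then show ?thesis using m by force
      next
        case False
        define S where "S = {y \<in> R - {x, z}. \<not> z \<sqsubset> y}"
        have "finite S" "S \<noteq> {}" using fin False by (auto simp: S_def)
        then obtain m where m: "m \<in> S" "\<And>y. y \<in> S \<Longrightarrow> \<not> y \<sqsubset> m"
          using exists_minimal by metis
        have "\<not> y \<sqsubset> m" if y: "y \<in> R" for y
        proof
          assume "y \<sqsubset> m"
          moreover from this have "y \<noteq> x" using iso(1)[of m] m by (auto simp: S_def)
          moreover have "y \<noteq> z" using \<open>y \<sqsubset> m\<close> m by (auto simp: S_def)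
          moreover have "\<not> z \<sqsubset> y" using \<open>y \<sqsubset> m\<close> m prec_trans[of z y m] by (auto simp: S_def)
          ultimately show False using m(2)[of y] y by (auto simp: S_def)
        qed
        then have "(m, True) \<in> moves R" using m by (simp add: moves_iff S_def)
        then show ?thesis using m by (force simp: S_def)
      qed
      then obtain k where k: "k \<in> moves R" "fst k \<noteq> x" by blast
      then have "g i = g k" "g k = g j" using True i j by (auto intro!: all simp: x_def)
      then show ?thesis by simp
    next
      case False
      then show ?thesis using all[OF i(1) j(1)] by (cases "i = j") auto
    qed
  next
    case 2
    have "{x \<in> R. x \<sqsubset> z} \<noteq> {}" using 2 unfolding below_def by (metis card.empty add_2_eq_Suc' nat.distinct(1))
    moreover have "finite {x \<in> R. x \<sqsubset> z}" using fin by simp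
    \<comment> \<open>A minimal predecessor of \<open>z\<close> is a hub: its removal alone brings
      the count below \<open>z\<close> down to \<open>a + 1\<close>.\<close>
    ultimately obtain m where m: "m \<in> R" "m \<sqsubset> z" "\<And>y. y \<in> R \<Longrightarrow> y \<sqsubset> z \<Longrightarrow> \<not> y \<sqsubset> m"
      using exists_minimal[of "{x \<in> R. x \<sqsubset> z}"] by (metis (no_types, lifting) mem_Collect_eq)
    have "\<not> y \<sqsubset> m" if "y \<in> R" for y
      using m(3)[OF that] prec_trans[of y m z] m(2) by blast
    moreover have "m \<noteq> z" using m(2) prec_irrefl by blast
    ultimately have hub: "(m, True) \<in> moves R" using m(1) by (simp add: moves_iff)
    have "g k = g (m, True)" if k: "k \<in> moves R" for k
    proof (cases "fst k = m")
      case True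
      then show ?thesis using same[OF k hub] m by simp
    next
      case False
      then have ne: "fst k \<noteq> fst (m, True)" by simp
      show ?thesis using del2[OF k hub ne] 2 m by (intro adj k hub ne) (auto split: if_splits)
    qed
    then show ?thesis using i j by simp
  next
    case 3
    have "{x \<in> R. z \<sqsubset> x} \<noteq> {}" using 3 unfolding above_def by (metis card.empty add_2_eq_Suc' nat.distinct(1))
    moreover have "finite {x \<in> R. z \<sqsubset> x}" using fin by simp
    ultimately obtain m where m: "m \<in> R" "z \<sqsubset> m" "\<And>y. y \<in> R \<Longrightarrow> z \<sqsubset> y \<Longrightarrow> \<not> m \<sqsubset> y"
      using exists_maximal[of "{x \<in> R. z \<sqsubset> x}"] by (metis (no_types, lifting) mem_Collect_eq)
    have "\<not> m \<sqsubset> y" if "y \<in> R" for y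
      using m(3)[OF that] prec_trans[of z m y] m(2) by blast
    moreover have "m \<noteq> z" using m(2) prec_irrefl by blast
    ultimately have hub: "(m, False) \<in> moves R" using m(1) by (simp add: moves_iff)
    have "g k = g (m, False)" if k: "k \<in> moves R" for k
    proof (cases "fst k = m")
      case True
      then show ?thesis using same[OF k hub] m by simp
    next
      case False
      then have ne: "fst k \<noteq> fst (m, False)" by simp
      show ?thesis using del2[OF k hub ne] 3 m by (intro adj k hub ne) (auto split: if_splits)
    qed
    then show ?thesis using i j by simp
  next
    case 4
    \<comment> \<open>With at least \<open>a + 3\<close> elements below \<open>z\<close>, a row is
      positive only if its move removes one of them. So both moves do, and they are joined
      directly.\<close>
    have "fst i \<sqsubset> z" using 4 bi(1) del1(1)[OF i(1)] by (intro ccontr[of "fst i \<sqsubset> z"]) simp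
    moreover have "fst j \<sqsubset> z" using 4 bj(1) del1(1)[OF j(1)] by (intro ccontr[of "fst j \<sqsubset> z"]) simp
    ultimately have lt: "fst i \<sqsubset> z" "fst j \<sqsubset> z" .
    have eq: "below R = a + 3" using 4 del1(1)[OF i(1)] bi(1) lt by simp
    then have le: "above R \<le> b" using tot card by simp
    show ?thesis
    proof (cases "fst i = fst j")
      case True
      then have "i = j" using same[OF i(1) j(1)] lt by blast
      then show ?thesis by simp
    next
      case False
      show ?thesis using del2[OF i(1) j(1) False] eq le lt
        by (intro adj[OF i(1) j(1) False]) (simp_all split: if_splits)
    qed
  next
    case 5
    have "z \<sqsubset> fst i" using 5 bi(2) del1(2)[OF i(1)] by (intro ccontr[of "z \<sqsubset> fst i"]) simp
    moreover have "z \<sqsubset> fst j" using 5 bj(2) del1(2)[OF j(1)] by (intro ccontr[of "z \<sqsubset> fst j"]) simp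
    ultimately have lt: "z \<sqsubset> fst i" "z \<sqsubset> fst j" .
    have eq: "above R = b + 3" using 5 del1(2)[OF i(1)] bi(2) lt by simp
    then have le: "below R \<le> a" using tot card by simp
    show ?thesis
    proof (cases "fst i = fst j")
      case True
      then have "i = j" using same[OF i(1) j(1)] lt by blast
      then show ?thesis by simp
    next
      case False
      show ?thesis using del2[OF i(1) j(1) False] eq le lt
        by (intro adj[OF i(1) j(1) False]) (simp_all split: if_splits)
    qed
  qed
qed

text \<open>At most two moves exist. The diagonal entries are at most
  \<open>\<omega> x * \<omega> y\<close> and 1, and the off-diagonal entry is
  \<open>\<omega> x\<close>, so the determinant condition follows from
  \<open>\<omega> y \<le> \<omega> x\<close>.\<close>

lemma hyperbolic_mat_three_comparable:
  assumes R: "good R" and xy: "R = {x, y, z}" "x \<noteq> z" "y \<noteq> z" "x \<sqsubset> y"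
  shows "hyperbolic (moves R) (mat R 0)"
proof (rule hyperbolic_pair)
  have ne: "x \<noteq> y" using xy prec_irrefl by blast
  have del: "R - {x} = {y, z}" "R - {y} = {x, z}" "R - {x} - {y} = {z}" "R - {y} - {x} = {z}"
    using xy ne by auto
  have w: "\<omega> x > 0" "\<omega> y > 0" "\<omega> x \<ge> \<omega> y"
    using weight_pos weight_antimono R xy by (auto simp: good_def prec_def)
  show sub: "moves R \<subseteq> {(x, True), (y, False)}"
    using xy by (auto simp: moves_def mins_def maxs_def)
  show "(x, True) \<noteq> (y, False)" by simp
  show "mat R 0 (y, False) (x, True) = mat R 0 (x, True) (y, False)" by (rule mat_sym)
  assume m: "(x, True) \<in> moves R" "(y, False) \<in> moves R"
  have fin: "finite (moves (R - {x}) - moves R)" "finite (moves (R - {y}) - moves R)"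
    using good_remove[OF R] xy(2,3) by (simp_all add: finite_moves)
  have "moves (R - {x}) - moves R \<subseteq> {(y, True)}"
  proof
    fix k assume k: "k \<in> moves (R - {x}) - moves R"
    then have "fst k \<in> R - {x}" "fst k \<noteq> z" unfolding Diff_iff moves_iff by blast+
    then have "k = (y, snd k)" unfolding del by (simp add: prod_eq_iff)
    then show "k \<in> {(y, True)}" using k m by (cases "snd k") auto
  qed
  then have "(\<Sum>k\<in>moves (R - {x}) - moves R. \<omega> x * wt k * F (R - {x} - {fst k}) 0)
      \<le> (\<Sum>k\<in>{(y, True)}. \<omega> x * wt k * F (R - {x} - {fst k}) 0)"
    using w xy(2,3)[symmetric] by (intro sum_mono2) (auto simp: wt_def del F_singleton)
  then have a: "mat R 0 (x, True) (x, True) \<le> \<omega> x * \<omega> y"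
    by (simp add: mat_def wt_def[of "(x, True)"] wt_def[of "(y, True)"] del(3,4) F_singleton)
  have "moves (R - {y}) - moves R \<subseteq> {(x, False)}"
  proof
    fix k assume k: "k \<in> moves (R - {y}) - moves R"
    then have "fst k \<in> R - {y}" "fst k \<noteq> z" unfolding Diff_iff moves_iff by blast+
    then have "k = (x, snd k)" unfolding del by (simp add: prod_eq_iff)
    then show "k \<in> {(x, False)}" using k m by (cases "snd k") auto
  qed
  then have "(\<Sum>k\<in>moves (R - {y}) - moves R. wt k * F (R - {y} - {fst k}) 0)
      \<le> (\<Sum>k\<in>{(x, False)}. wt k * F (R - {y} - {fst k}) 0)"
    using w xy(2,3)[symmetric] by (intro sum_mono2) (auto simp: wt_def del F_singleton)
  then have b: "mat R 0 (y, False) (y, False) \<le> 1"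
    by (simp add: mat_def wt_def[of "(y, False)"] wt_def[of "(x, False)"] del(3,4) F_singleton)
  have "mat R 0 (x, True) (x, True) * mat R 0 (y, False) (y, False) \<le> \<omega> x * \<omega> y * 1"
    using a b w mat_nonneg[OF R m(1) m(1)] mat_nonneg[OF R m(2) m(2)]
    by (intro mult_mono) auto
  also have "\<dots> \<le> (\<omega> x)\<^sup>2" using w by (simp add: power2_eq_square)
  also have "\<omega> x = mat R 0 (x, True) (y, False)"
    using ne xy(3)[symmetric] by (simp add: mat_def wt_def del F_singleton)
  finally show "mat R 0 (x, True) (x, True) * mat R 0 (y, False) (y, False)
      \<le> (mat R 0 (x, True) (y, False))\<^sup>2" .
qed

text \<open>No removal releases a move, so the diagonal vanishes and the form is a symmetrized
  product of two linear forms, one for \<open>x\<close> and one for \<open>y\<close>; each may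
  involve two moves.\<close>

lemma hyperbolic_mat_three_incomparable:
  assumes R: "good R" and xy: "R = {x, y, z}" "x \<noteq> z" "y \<noteq> z" "x \<noteq> y" "\<not> x \<sqsubset> y" "\<not> y \<sqsubset> x"
  shows "hyperbolic (moves R) (mat R 0)"
proof -
  let ?I = "\<lambda>w. {i \<in> moves R. fst i = w}"
  define f where "f w u = (\<Sum>i\<in>?I w. wt i * u i)" for w u
  have fin: "finite (moves R)" using R by (rule finite_moves)
  have fst: "fst i = x \<or> fst i = y" if "i \<in> moves R" for i
    using that xy by (auto simp: moves_iff)
  have split: "(\<Sum>i\<in>moves R. h i) = (\<Sum>i\<in>?I x. h i) + (\<Sum>i\<in>?I y. h i)" for h :: "'a \<times> bool \<Rightarrow> real"
  proof -
    have "moves R = ?I x \<union> ?I y" using fst by auto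
    then have "(\<Sum>i\<in>moves R. h i) = (\<Sum>i\<in>?I x \<union> ?I y. h i)" by simp
    also have "\<dots> = (\<Sum>i\<in>?I x. h i) + (\<Sum>i\<in>?I y. h i)"
      using fin xy by (intro sum.union_disjoint) auto
    finally show ?thesis .
  qed
  have mat: "mat R 0 i j = (if fst i = fst j then 0 else wt i * wt j)"
    if ij: "i \<in> moves R" "j \<in> moves R" for i j
  proof (cases "i = j")
    case True
    have "moves (del R i) - moves R = {}"
      using fst[OF ij(1)] xy prec_irrefl by (auto simp: moves_iff split: if_splits)
    then have "mat R 0 i i = 0" unfolding mat_def by (simp only: sum.empty if_True refl)
    then show ?thesis using True by simp
  next
    case False
    show ?thesis
    proof (cases "fst i = fst j")
      case True
      then show ?thesis using False by (simp add: mat_def)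
    next
      case ne: False
      then have "del (del R i) j = {z}" using fst[OF ij(1)] fst[OF ij(2)] xy by auto
      then show ?thesis using False ne by (simp add: mat_def F_singleton)
    qed
  qed
  have row: "(\<Sum>j\<in>moves R. mat R 0 i j * v j) = wt i * (if fst i = x then f y v else f x v)"
    if i: "i \<in> moves R" for i v
  proof (cases "fst i = x")
    case True
    have "(\<Sum>j\<in>?I x. mat R 0 i j * v j) = 0"
      using True i by (intro sum.neutral) (simp add: mat)
    moreover have "(\<Sum>j\<in>?I y. mat R 0 i j * v j) = wt i * f y v"
      unfolding f_def sum_distrib_left using True i xy(4) by (intro sum.cong) (auto simp: mat)
    ultimately show ?thesis using True unfolding split by simp
  next
    case False
    then have y: "fst i = y" using fst[OF i] by simp
    have "(\<Sum>j\<in>?I y. mat R 0 i j * v j) = 0"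
      using y i by (intro sum.neutral) (simp add: mat)
    moreover have "(\<Sum>j\<in>?I x. mat R 0 i j * v j) = wt i * f x v"
      unfolding f_def sum_distrib_left using y i xy(4) by (intro sum.cong) (auto simp: mat)
    ultimately show ?thesis using False unfolding split by simp
  qed
  have form: "B R 0 u v = f x u * f y v + f y u * f x v" for u v
  proof -
    have "B R 0 u v = (\<Sum>i\<in>moves R. u i * (wt i * (if fst i = x then f y v else f x v)))"
      unfolding bform_def by (intro sum.cong refl) (simp add: row)
    also have "\<dots> = f x u * f y v + f y u * f x v"
      unfolding split f_def[of _ u] sum_distrib_right using xy
      by (intro arg_cong2[where f = "(+)"] sum.cong) auto
    finally show ?thesis .
  qed
  show ?thesis unfolding hyperbolic_def form
  proof (intro allI impI)
    fix u v
    have "(f x u * f y v + f y u * f x v)\<^sup>2 -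
        (f x u * f y u + f y u * f x u) * (f x v * f y v + f y v * f x v)
      = (f x u * f y v - f y u * f x v)\<^sup>2"
      by (simp add: power2_eq_square algebra_simps)
    then show "(f x u * f y u + f y u * f x u) * (f x v * f y v + f y v * f x v)
        \<le> (f x u * f y v + f y u * f x v)\<^sup>2"
      by (metis diff_ge_0_iff_ge zero_le_power2)
  qed
qed

lemma hyperbolic_mat_three:
  assumes R: "good R" and card: "card R = 3"
  shows "hyperbolic (moves R) (mat R 0)"
proof -
  have "card (R - {z}) = 2" using R card finite_good[OF R] by (simp add: good_def)
  then obtain x y where xy: "R - {z} = {x, y}" "x \<noteq> y" by (meson card_2_iff)
  then have *: "x \<noteq> z" "y \<noteq> z" "R = {x, y, z}" "R = {y, x, z}" using R by (auto simp: good_def)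
  show ?thesis
    using hyperbolic_mat_three_comparable[OF R *(3,1,2)] hyperbolic_mat_three_comparable[OF R *(4,2,1)]
      hyperbolic_mat_three_incomparable[OF R *(3,1,2) xy(2)] by blast
qed

lemma hyperbolic_mat2:
  assumes R: "good R" and card: "a + 4 \<le> card R" and coef: "\<alpha> > 0" "\<beta> > 0"
    and IH: "\<And>i. i \<in> moves R \<Longrightarrow> hyperbolic (moves (del R i)) (mat (del R i) a)"
  shows "hyperbolic (moves R) (mat2 R a \<alpha> \<beta>)"
proof (rule hyperbolic_of_pull)
  let ?h = "side \<alpha> \<beta>"
  show "finite (moves R)" using R by (rule finite_moves)
  show "\<forall>i\<in>moves R. \<forall>j\<in>moves R. mat2 R a \<alpha> \<beta> i j = mat2 R a \<alpha> \<beta> j i"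
    unfolding mat2_def by (metis mat_sym)
  show "mat2 R a \<alpha> \<beta> i j \<ge> 0" if "i \<in> moves R" "j \<in> moves R" for i j
    using that R coef mat_nonneg by (simp add: mat2_def less_imp_le)
  show h: "?h i > 0" for i using coef by (simp add: side_def)
  have b: "card R = a + (card R - a - 4) + 4" using card by simp
  show "g i = g j"
    if "\<And>i j. i \<in> moves R \<Longrightarrow> j \<in> moves R \<Longrightarrow> mat2 R a \<alpha> \<beta> i j \<noteq> 0 \<Longrightarrow> g i = g j"
      "i \<in> moves R" "j \<in> moves R" "(\<Sum>k\<in>moves R. mat2 R a \<alpha> \<beta> i k * ?h k) > 0"
      "(\<Sum>k\<in>moves R. mat2 R a \<alpha> \<beta> j k * ?h k) > 0" for g :: "'a \<times> bool \<Rightarrow> real" and i j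
    by (rule moves_connected[OF R b coef that(1) that(2,4,3,5)])
  fix v
  have "bform (moves R) (mat2 R a \<alpha> \<beta>) v v
      \<le> (\<Sum>i\<in>moves R. wt i * ?h i * B (del R i) a (tr R i v) (tr R i v))"
    using pull[OF R card] coef by (simp add: less_imp_le)
  also have "\<dots> \<le> (\<Sum>i\<in>moves R. ?h i * (\<Sum>j\<in>moves R. mat2 R a \<alpha> \<beta> i j * v j)\<^sup>2
      / (\<Sum>j\<in>moves R. mat2 R a \<alpha> \<beta> i j * ?h j))"
  proof (rule sum_mono)
    fix i assume i: "i \<in> moves R"
    let ?S = "del R i"
    define q where "q = B ?S a (tr R i v) (tr R i v)"
    define p where "p = B ?S a (tr R i v) ?h"
    define d where "d = B ?S a ?h ?h"
    have S: "good ?S" using R i by (rule good_del)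
    have rows: "(\<Sum>j\<in>moves R. mat2 R a \<alpha> \<beta> i j * v j) = wt i * p"
      "(\<Sum>j\<in>moves R. mat2 R a \<alpha> \<beta> i j * ?h j) = wt i * d"
      unfolding mat2_row[OF R i card] p_def d_def
      using B_tr_side[OF R i] B_sym by metis+
    have "d \<ge> 0" unfolding d_def bform_def using mat_nonneg[OF S] h
      by (intro sum_nonneg mult_nonneg_nonneg) (auto simp: less_imp_le)
    then consider "d = 0" | "d > 0" by linarith
    \<comment> \<open>For \<open>d > 0\<close> this is hyperbolicity of the smaller form. For
      \<open>d = 0\<close> the nonnegative matrix vanishes, so \<open>q = 0\<close>, and the
      quotient below has denominator 0 and hence value 0.\<close>
    then have "q * d \<le> p\<^sup>2 \<and> (d = 0 \<longrightarrow> q = 0)"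
    proof cases
      case 1
      have "q = 0" unfolding q_def
        by (rule bform_eq_0[OF finite_moves[OF S] mat_nonneg[OF S] h]) (use 1 in \<open>simp_all add: d_def\<close>)
      with 1 show ?thesis by simp
    next
      case 2
      then have "q * d \<le> p\<^sup>2"
        using IH[OF i, unfolded hyperbolic_def] unfolding q_def p_def d_def by simp
      with 2 show ?thesis by simp
    qed
    moreover have "wt i > 0" using wt_pos[OF R i] .
    ultimately have "wt i * q \<le> (wt i * p)\<^sup>2 / (wt i * d)"
      using \<open>d \<ge> 0\<close> by (cases "d = 0") (auto simp: field_simps power2_eq_square)
    then have "?h i * (wt i * q) \<le> ?h i * ((wt i * p)\<^sup>2 / (wt i * d))"
      using h[of i] by (intro mult_left_mono) auto
    then show "wt i * ?h i * B ?S a (tr R i v) (tr R i v)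
        \<le> ?h i * (\<Sum>j\<in>moves R. mat2 R a \<alpha> \<beta> i j * v j)\<^sup>2 / (\<Sum>j\<in>moves R. mat2 R a \<alpha> \<beta> i j * ?h j)"
      unfolding rows q_def[symmetric] by (simp add: mult_ac)
  qed
  finally show "bform (moves R) (mat2 R a \<alpha> \<beta>) v v
    \<le> (\<Sum>i\<in>moves R. ?h i * (\<Sum>j\<in>moves R. mat2 R a \<alpha> \<beta> i j * v j)\<^sup>2
      / (\<Sum>j\<in>moves R. mat2 R a \<alpha> \<beta> i j * ?h j))" .
qed

lemma hyperbolic_mat:
  assumes "good R" "a + 3 \<le> card R"
  shows "hyperbolic (moves R) (mat R a)"
  using assms
proof (induction "card R" arbitrary: R a rule: less_induct)
  case less
  note R = \<open>good R\<close>
  have mat2: "hyperbolic (moves R) (mat2 R c \<alpha> \<beta>)" if "c + 4 \<le> card R" "\<alpha> > 0" "\<beta> > 0" for c \<alpha> \<beta>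
  proof (rule hyperbolic_mat2[OF R that])
    fix i assume i: "i \<in> moves R"
    show "hyperbolic (moves (del R i)) (mat (del R i) c)"
      using that card_del[OF R i] by (intro less.hyps good_del[OF R i]) auto
  qed
  \<comment> \<open>Level \<open>a\<close> is mixed with the level just below it. For
    \<open>a = 0\<close> level 1 takes its place; in general the level above would need
    \<open>a + 4 \<le> card R\<close>.\<close>
  consider "card R = 3" | "card R \<ge> 4" "a = 0" | c where "a = Suc c" "c + 4 \<le> card R"
  proof -
    have "card R = 3 \<or> card R \<ge> 4" using less.prems by linarith
    then show ?thesis using that less.prems by (cases a) auto
  qed
  then show ?case
  proof cases
    case 1
    then show ?thesis using hyperbolic_mat_three[OF R] less.prems by simp
  next
    case 2
    show ?thesis
    proof (rule hyperbolic_limit[where N = "mat R (Suc 0)"])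
      fix t :: real assume "t > 0"
      then show "hyperbolic (moves R) (\<lambda>i j. mat R a i j + t * mat R (Suc 0) i j)"
        using mat2[of 0 t 1] 2 by (simp add: mat2_def[abs_def] add.commute)
    qed
  next
    case 3
    show ?thesis
    proof (rule hyperbolic_limit[where N = "mat R c"])
      fix t :: real assume "t > 0"
      then show "hyperbolic (moves R) (\<lambda>i j. mat R a i j + t * mat R c i j)"
        using mat2[of c 1 t] 3 by (simp add: mat2_def[abs_def])
    qed
  qed
qed

section \<open>The equality case\<close>

lemma equality_kernel:
  assumes R: "good R" and card: "a + 3 \<le> card R" and pos: "F R (Suc a) > 0"
    and eq: "(F R (Suc a))\<^sup>2 = F R (Suc (Suc a)) * F R a"
  obtains s where "s > 0" "\<And>u. B R a (side 1 (- s)) u = 0"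
proof
  \<comment> \<open>The common ratio of the three counts. It makes p - \<open>?s\<close> q
    orthogonal to q, whose value is positive, and null.\<close>
  let ?s = "F R (Suc (Suc a)) / F R (Suc a)"
  have "F R (Suc (Suc a)) * F R a > 0" using pos eq by (metis zero_less_power)
  then have pos': "F R (Suc (Suc a)) > 0" "F R a > 0"
    using F_nonneg[OF R] by (auto simp: zero_less_mult_iff not_less[symmetric])
  then show "?s > 0" using pos by simp
  have s: "?s * F R a = F R (Suc a)" "?s * F R (Suc a) = F R (Suc (Suc a))"
    using pos eq by (auto simp: field_simps power2_eq_square)
  show "B R a (side 1 (- ?s)) u = 0" for u
  proof (rule hyperbolic_kernel[OF hyperbolic_mat[OF R card]])
    show "\<forall>i\<in>moves R. \<forall>j\<in>moves R. mat R a i j = mat R a j i" using mat_sym by blast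
    show "B R a (side 0 1) (side 0 1) > 0" using pos' by (simp add: B_side_side[OF R card])
    have "B R a (side 1 (- ?s)) (side 0 1) = F R (Suc a) - ?s * F R a"
      unfolding B_side_side[OF R card] by simp
    then show "B R a (side 1 (- ?s)) (side 0 1) = 0" by (simp only: s)
    have "B R a (side 1 (- ?s)) (side 1 (- ?s)) =
        (F R (Suc (Suc a)) - ?s * F R (Suc a)) - ?s * (F R (Suc a) - ?s * F R a)"
      unfolding B_side_side[OF R card] by (simp only: algebra_simps)
    then show "B R a (side 1 (- ?s)) (side 1 (- ?s)) = 0"
      by (simp only: s diff_self mult_zero_right)
  qed
qed

section \<open>Inheritance of the kernel by smaller sets\<close>

lemma B_tr_side_side:
  assumes "good R" "i \<in> moves R"
  shows "B (del R i) a (tr R i (side \<alpha> \<beta>)) (tr R i (side \<alpha> \<beta>)) = B (del R i) a (side \<alpha> \<beta>) (side \<alpha> \<beta>)"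
  using assms tr_side by (intro bform_cong) auto

text \<open>Testing the kernel vector against a unit vector gives a row, that is, the linear form of
  the smaller set at p - s q. Its vanishing says that two consecutive counts there have ratio
  \<open>s\<close>.\<close>

lemma kernel_row:
  assumes R: "good R" and card: "a + 3 \<le> card R" and ker: "\<And>u. B R a (side 1 (- s)) u = 0"
    and i: "i \<in> moves R"
  shows "F (del R i) (Suc a) = s * F (del R i) a"
proof -
  have "wt i * lin (del R i) a (tr R i (side 1 (- s))) = 0"
    using ker[of "\<lambda>j. if j = i then 1 else 0"] bform_point[OF finite_moves[OF R] i]
    unfolding mat_row[OF R i, symmetric] B_sym[of R a "side 1 (- s)"] by metis
  then have "lin (del R i) a (tr R i (side 1 (- s))) = 0" using wt_pos[OF R i] by simp
  also have "lin (del R i) a (tr R i (side 1 (- s))) = lin (del R i) a (side 1 (- s))"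
    using i by (intro lin_cong tr_side)
  finally show ?thesis
    using lin_side[of "del R i" a 1 "- s"] R i card by (simp add: good_del card_del)
qed

text \<open>
  By \<open>pull\<close> the nonpositive numbers \<open>Q v\<close> of the children have a nonnegative weighted sum, so
  all of them vanish, and a null vector orthogonal to a positive vector lies in the kernel.
\<close>

lemma kernel_child:
  assumes R: "good R" and card: "a + 4 \<le> card R" and nonneg: "\<alpha> \<ge> 0" "\<beta> \<ge> 0"
    and null: "bform (moves R) (mat2 R a \<alpha> \<beta>) (side 1 (- s)) (side 1 (- s)) = 0"
    and orth: "\<And>k. k \<in> moves R \<Longrightarrow> side \<alpha> \<beta> k > 0 \<Longrightarrow> B (del R k) a (side 1 (- s)) (side \<alpha> \<beta>) = 0"
    and degenerate: "\<And>k. k \<in> moves R \<Longrightarrow> side \<alpha> \<beta> k > 0 \<Longrightarrow>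
      \<not> B (del R k) a (side \<alpha> \<beta>) (side \<alpha> \<beta>) > 0 \<Longrightarrow> B (del R k) a (side 1 (- s)) (side 1 (- s)) \<le> 0"
    and i: "i \<in> moves R" "side \<alpha> \<beta> i > 0" and pos: "B (del R i) a (side \<alpha> \<beta>) (side \<alpha> \<beta>) > 0"
  shows "B (del R i) a (side 1 (- s)) u = 0"
proof -
  let ?h = "side \<alpha> \<beta>" and ?v = "side 1 (- s)"
  have hyp: "hyperbolic (moves (del R k)) (mat (del R k) a)" if "k \<in> moves R" for k
    using hyperbolic_mat[OF good_del[OF R that], of a] card_del[OF R that] card by simp
  let ?f = "\<lambda>k. wt k * ?h k * B (del R k) a ?v ?v"
  have "?f i = 0"
  proof (rule sum_nonpos_eq_0[OF finite_moves[OF R] _ _ i(1)])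
    show "?f k \<le> 0" if k: "k \<in> moves R" for k
    proof (cases "?h k = 0")
      case False
      then have h: "?h k > 0" using nonneg by (auto simp: side_def split: if_splits)
      have "B (del R k) a ?v ?v \<le> 0"
        using degenerate[OF k h] hyperbolic_nonpos[OF hyp[OF k] _ orth[OF k h]] by blast
      then show ?thesis using h wt_pos[OF R k] by (intro mult_nonneg_nonpos) auto
    qed simp
    have "0 \<le> (\<Sum>k\<in>moves R. wt k * ?h k * B (del R k) a (tr R k ?v) (tr R k ?v))"
      using pull[OF R card nonneg, of ?v] null by simp
    also have "\<dots> = (\<Sum>k\<in>moves R. ?f k)"
      by (intro sum.cong refl) (simp only: B_tr_side_side[OF R])
    finally show "0 \<le> (\<Sum>k\<in>moves R. ?f k)" .
  qed
  then have "B (del R i) a ?v ?v = 0" using i wt_pos[OF R i(1)] by simp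
  moreover have "\<forall>k\<in>moves (del R i). \<forall>j\<in>moves (del R i). mat (del R i) a k j = mat (del R i) a j k"
    using mat_sym by blast
  ultimately show ?thesis using hyperbolic_kernel[OF hyp[OF i(1)] _ pos orth[OF i]] by blast
qed

lemma below_del_le: "good R \<Longrightarrow> below (del R i) \<le> below R"
  and above_del_le: "good R \<Longrightarrow> above (del R i) \<le> above R"
  unfolding below_def above_def using finite_good[of R] by (auto intro!: card_mono)

text \<open>Here h = p, so only lower moves carry a coefficient. After any one removal, levels
  \<open>a + 1\<close> and \<open>a + 2\<close> have ratio \<open>s\<close>, which makes p - s q
  orthogonal to p. If these levels vanish, so does level \<open>a\<close>: there is room for at most
  \<open>b + 1\<close> elements above \<open>z\<close>, already in \<open>R\<close>, so positivity
  at \<open>a\<close> would give positivity at \<open>a + 1\<close>.\<close>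

lemma kernel_down:
  assumes R: "good R" and card: "card R = a + b + 4" and s: "s > 0"
    and ker: "\<And>u. B R (Suc a) (side 1 (- s)) u = 0" and pos: "F R (Suc (Suc a)) > 0"
    and i: "i \<in> moves R" "snd i" "F (del R i) (Suc a) > 0"
  shows "B (del R i) a (side 1 (- s)) u = 0"
proof (rule kernel_child[where \<alpha> = 1 and \<beta> = 0, OF R])
  show "a + 4 \<le> card R" using card by simp
  show "bform (moves R) (mat2 R a 1 0) (side 1 (- s)) (side 1 (- s)) = 0"
    by (simp add: bform_mat2 ker)
  have form: "B (del R k) a (side \<alpha> \<beta>) (side \<gamma> \<delta>) = \<alpha> * \<gamma> * F (del R k) (Suc (Suc a))
      + (\<alpha> * \<delta> + \<beta> * \<gamma>) * F (del R k) (Suc a) + \<beta> * \<delta> * F (del R k) a"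
    if "k \<in> moves R" for k \<alpha> \<beta> \<gamma> \<delta>
    using that card by (intro B_side_side good_del[OF R]) (simp_all add: card_del[OF R])
  have row: "F (del R k) (Suc (Suc a)) = s * F (del R k) (Suc a)" if "k \<in> moves R" for k
    using kernel_row[OF R _ ker that] card by simp
  show "B (del R k) a (side 1 (- s)) (side 1 0) = 0" if "k \<in> moves R" for k
    using that by (simp add: form row)
  show "B (del R k) a (side 1 (- s)) (side 1 (- s)) \<le> 0"
    if k: "k \<in> moves R" and "\<not> B (del R k) a (side 1 0) (side 1 0) > 0" for k
  proof -
    let ?S = "del R k"
    have S: "good ?S" "card ?S = a + b + 3" using R k card by (simp_all add: good_del card_del)
    have "\<not> F ?S (Suc (Suc a)) > 0" using that by (simp add: form)
    then have z: "F ?S (Suc (Suc a)) = 0" using F_nonneg[OF S(1), of "Suc (Suc a)"] by simp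
    then have z': "F ?S (Suc a) = 0" using row[OF k] s by simp
    have "\<not> F ?S a > 0"
    proof
      assume "F ?S a > 0"
      then have "below ?S \<le> a" using F_posD(1)[of ?S a "b + 2"] S by simp
      moreover have "above ?S \<le> b + 1"
        using F_posD(2)[OF R _ pos, of "b + 1"] card above_del_le[OF R, of k] by simp
      ultimately have "F ?S (Suc a) > 0" using F_pos[of ?S "Suc a" "b + 1"] S by simp
      with z' show False by simp
    qed
    then have "F ?S a = 0" using F_nonneg[OF S(1), of a] by simp
    with z z' show ?thesis using k by (simp add: form)
  qed
  show "B (del R i) a (side 1 0) (side 1 0) > 0"
    using i s by (simp add: form row)
qed (use i in \<open>auto simp: side_def\<close>)

text \<open>The mirror image, with h = q: orthogonality to q uses levels \<open>a\<close> and
  \<open>a + 1\<close>, and level \<open>a + 2\<close> cannot be positive alone because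
  \<open>below R \<le> a + 1\<close>.\<close>

lemma kernel_up:
  assumes R: "good R" and card: "card R = a + b + 4" and s: "s > 0"
    and ker: "\<And>u. B R a (side 1 (- s)) u = 0" and pos: "F R (Suc a) > 0"
    and i: "i \<in> moves R" "\<not> snd i" "F (del R i) (Suc a) > 0"
  shows "B (del R i) a (side 1 (- s)) u = 0"
proof (rule kernel_child[where \<alpha> = 0 and \<beta> = 1, OF R])
  show "a + 4 \<le> card R" using card by simp
  show "bform (moves R) (mat2 R a 0 1) (side 1 (- s)) (side 1 (- s)) = 0"
    by (simp add: bform_mat2 ker)
  have form: "B (del R k) a (side \<alpha> \<beta>) (side \<gamma> \<delta>) = \<alpha> * \<gamma> * F (del R k) (Suc (Suc a))
      + (\<alpha> * \<delta> + \<beta> * \<gamma>) * F (del R k) (Suc a) + \<beta> * \<delta> * F (del R k) a"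
    if "k \<in> moves R" for k \<alpha> \<beta> \<gamma> \<delta>
    using that card by (intro B_side_side good_del[OF R]) (simp_all add: card_del[OF R])
  have row: "F (del R k) (Suc a) = s * F (del R k) a" if "k \<in> moves R" for k
    using kernel_row[OF R _ ker that] card by simp
  show "B (del R k) a (side 1 (- s)) (side 0 1) = 0" if "k \<in> moves R" for k
    using that by (simp add: form row)
  show "B (del R k) a (side 1 (- s)) (side 1 (- s)) \<le> 0"
    if k: "k \<in> moves R" and "\<not> B (del R k) a (side 0 1) (side 0 1) > 0" for k
  proof -
    let ?S = "del R k"
    have S: "good ?S" "card ?S = a + b + 3" using R k card by (simp_all add: good_del card_del)
    have "\<not> F ?S a > 0" using that by (simp add: form)
    then have z: "F ?S a = 0" using F_nonneg[OF S(1), of a] by simp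
    then have z': "F ?S (Suc a) = 0" using row[OF k] by simp
    have "\<not> F ?S (Suc (Suc a)) > 0"
    proof
      assume "F ?S (Suc (Suc a)) > 0"
      then have "above ?S \<le> b" using F_posD(2)[of ?S "Suc (Suc a)" b] S by simp
      moreover have "below ?S \<le> a + 1"
        using F_posD(1)[OF R _ pos, of "b + 2"] card below_del_le[OF R, of k] by simp
      ultimately have "F ?S (Suc a) > 0" using F_pos[of ?S "Suc a" "b + 1"] S by simp
      with z' show False by simp
    qed
    then have "F ?S (Suc (Suc a)) = 0" using F_nonneg[OF S(1), of "Suc (Suc a)"] by simp
    with z z' show ?thesis using k by (simp add: form)
  qed
  have "F (del R i) a > 0" using i(3) s unfolding row[OF i(1)] by (simp add: zero_less_mult_iff)
  then show "B (del R i) a (side 0 1) (side 0 1) > 0"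
    using i by (simp add: form)
qed (use i in \<open>auto simp: side_def\<close>)

section \<open>Descent to the two neighbours of \<open>z\<close>\<close>

lemma F_pos_of_extension:
  assumes "good R" "L \<in> linear_extensions_at R r z (Suc a)"
  shows "F R a > 0"
  unfolding F_def using assms weight_pos finite_good
  by (subst N_weighted_pos_iff) (auto simp: good_def)

text \<open>Both counts are positive, so \<open>y\<close> can stand on either side of
  \<open>z\<close>; the counts are then \<open>\<omega> y\<close> and 1.\<close>

lemma pair_equality:
  assumes R: "good {y, z}" and y: "y \<noteq> z" and s: "s > 0"
    and eq: "F {y, z} 1 = s * F {y, z} 0" and pos: "F {y, z} 0 > 0"
  shows "\<omega> y = s" "\<not> y \<sqsubset> z" "\<not> z \<sqsubset> y"
proof -
  have pos1: "F {y, z} 1 > 0" using eq pos s by simp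
  show lt: "\<not> y \<sqsubset> z"
    using F_posD(1)[OF R, of 0 1] pos y unfolding below_def by (auto simp: Collect_conv_if)
  show gt: "\<not> z \<sqsubset> y"
    using F_posD(2)[OF R, of 1 0] pos1 y unfolding above_def by (auto simp: Collect_conv_if)
  have m: "mins r z {y, z} = {y}" "maxs r z {y, z} = {y}"
    using y lt gt prec_irrefl by (auto simp: mins_def maxs_def)
  have d: "{y, z} - {y} = {z}" using y by auto
  have "F {y, z} 1 = \<omega> y" using F_mins[OF R, of 0] by (simp add: m d F_singleton)
  moreover have "F {y, z} 0 = 1" using F_maxs[OF R, of 0] y by (simp add: m d F_singleton)
  ultimately show "\<omega> y = s" using eq by simp
qed

text \<open>Induction on the number \<open>a + b\<close> of elements other than \<open>z\<close> and
  its neighbours in \<open>L\<close>. An element at an end of \<open>L\<close> is removed, and what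
  is left of \<open>L\<close> certifies the positive middle count that \<open>kernel_down\<close>
  and \<open>kernel_up\<close> require.\<close>

lemma kernel_neighbours:
  assumes "good R" "card R = a + b + 3" and s: "s > 0"
    and "\<And>u. B R a (side 1 (- s)) u = 0" "L \<in> linear_extensions_at R r z (a + 2)"
    and "x \<in> R" "L x = a + 1 \<or> L x = a + 3"
  shows "\<omega> x = s \<and> \<not> x \<sqsubset> z \<and> \<not> z \<sqsubset> x"
  using assms
proof (induction "a + b" arbitrary: a b R L)
  case 0
  then have ab: "a = 0" "b = 0" by auto
  note R = \<open>good R\<close>
  have card: "card R = 3" and L: "L \<in> linear_extensions_at R r z (Suc (Suc 0))"
    using 0 ab by (auto simp: numeral_2_eq_2)
  have fin: "finite R" and z: "z \<in> R" using R finite_good by (auto simp: good_def)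
  have Lz: "L z = 2" and inj: "inj_on L R" using L fin by (auto simp: linear_extensions_at_iff)
  obtain p where p: "p \<in> R" "L p = 1" using linear_extensions_at_surj[OF L, of 1] card by auto
  obtain q where q: "q \<in> R" "L q = 3" using linear_extensions_at_surj[OF L, of 3] card by auto
  have ne: "p \<noteq> z" "q \<noteq> z" "p \<noteq> q" using p q Lz by auto
  have "R = {p, q, z}"
    using card_subset_eq[of R "{p, q, z}"] fin p q z ne card by auto
  then have d: "R - {p} = {q, z}" "R - {q} = {p, z}" using ne by auto
  have ker: "\<And>u. B R 0 (side 1 (- s)) u = 0" using 0 ab by simp
  have P: "(p, True) \<in> moves R" "behead R p L \<in> linear_extensions_at {q, z} r z (Suc 0)"
    using behead_in[OF fin z L _ p] d by (auto simp: moves_def)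
  have Q: "(q, False) \<in> moves R" "restrict L {p, z} \<in> linear_extensions_at {p, z} r z (Suc (Suc 0))"
    using restrict_last_in[OF fin z L _ q(1)] card q d by (auto simp: moves_def)
  have good: "good {q, z}" "good {p, z}"
    using good_del[OF R P(1)] good_del[OF R Q(1)] d by simp_all
  \<comment> \<open>Removing \<open>p\<close> leaves \<open>q\<close> and \<open>z\<close>, so the
    row of \<open>p\<close> speaks about \<open>q\<close>, and conversely.\<close>
  have eqs: "F {q, z} 1 = s * F {q, z} 0" "F {p, z} 1 = s * F {p, z} 0"
    using kernel_row[OF R _ ker P(1)] kernel_row[OF R _ ker Q(1)] card d by simp_all
  have pos: "F {q, z} 0 > 0" using F_pos_of_extension[OF good(1) P(2)] .
  have "F {p, z} 1 > 0" using F_pos_of_extension[OF good(2) Q(2)] by simp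
  then have pos': "F {p, z} 0 > 0" using eqs s by (simp add: zero_less_mult_iff)
  have "x = p \<or> x = q"
    using inj_onD[OF inj, of x p] inj_onD[OF inj, of x q] 0 ab p q by (auto simp: numeral_3_eq_3)
  then show ?case
    using pair_equality[OF good(1) ne(2) s eqs(1) pos] pair_equality[OF good(2) ne(1) s eqs(2) pos']
    by blast
next
  case (Suc m)
  note R = \<open>good R\<close> and L = \<open>L \<in> linear_extensions_at R r z (a + 2)\<close>
  have fin: "finite R" and z: "z \<in> R" using R finite_good by (auto simp: good_def)
  have pos: "F R (Suc a) > 0" using F_pos_of_extension[OF R, of L "Suc a"] L by simp
  consider a' where "a = Suc a'" | b' where "b = Suc b'" using Suc.hyps(2) by (cases a; cases b) auto
  then show ?case
  proof cases
    case 1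
    have L': "L \<in> linear_extensions_at R r z (Suc (a' + 2))" using L 1 by simp
    obtain p where p: "p \<in> R" "L p = 1"
      using linear_extensions_at_surj[OF L, of 1] Suc.prems(2) by auto
    have P: "(p, True) \<in> moves R" "behead R p L \<in> linear_extensions_at (R - {p}) r z (a' + 2)"
      using behead_in[OF fin z L' _ p] by (auto simp: moves_def)
    have good: "good (R - {p})" "card (R - {p}) = a' + b + 3"
      using good_del[OF R P(1)] card_del[OF R P(1)] Suc.prems(2) 1 by simp_all
    have pos': "F (R - {p}) (Suc a') > 0"
      using F_pos_of_extension[OF good(1), of "behead R p L" "Suc a'"] P(2) by simp
    have ker: "B (R - {p}) a' (side 1 (- s)) u = 0" for u
      using kernel_down[OF R _ s _ _ P(1), of a' b u] Suc.prems(2,4) pos pos' 1 by simp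
    have "x \<noteq> p" using Suc.prems(7) p 1 by auto
    then have "x \<in> R - {p}" "behead R p L x = a' + 1 \<or> behead R p L x = a' + 3"
      using Suc.prems(6,7) 1 by (auto simp: behead_def)
    then show ?thesis
      using Suc.hyps(1)[OF _ good s ker P(2)] Suc.hyps(2) 1 by simp
  next
    case 2
    have lt: "a + 2 < card R" using Suc.prems(2) 2 by simp
    obtain q where q: "q \<in> R" "L q = card R"
      using linear_extensions_at_surj[OF L, of "card R"] lt by auto
    have Q: "(q, False) \<in> moves R" "restrict L (R - {q}) \<in> linear_extensions_at (R - {q}) r z (a + 2)"
      using restrict_last_in[OF fin z L lt q] by (auto simp: moves_def)
    have good: "good (R - {q})" "card (R - {q}) = a + b' + 3"
      using good_del[OF R Q(1)] card_del[OF R Q(1)] Suc.prems(2) 2 by simp_all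
    have pos': "F (R - {q}) (Suc a) > 0"
      using F_pos_of_extension[OF good(1), of "restrict L (R - {q})" "Suc a"] Q(2) by simp
    have ker: "B (R - {q}) a (side 1 (- s)) u = 0" for u
      using kernel_up[OF R _ s _ _ Q(1), of a b' u] Suc.prems(2,4) pos pos' 2 by simp
    have "x \<noteq> q" using Suc.prems(2,7) q 2 by auto
    then have "x \<in> R - {q}" "restrict L (R - {q}) x = a + 1 \<or> restrict L (R - {q}) x = a + 3"
      using Suc.prems(6,7) by auto
    then show ?thesis
      using Suc.hyps(1)[OF _ good s ker Q(2)] Suc.hyps(2) 2 by simp
  qed
qed

lemma extension_with_successor:
  assumes "good R" "x \<in> R" "z \<sqsubset> x" and cover: "\<And>w. w \<in> R \<Longrightarrow> \<not> (z \<sqsubset> w \<and> w \<sqsubset> x)"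
    and "card R = a + b + 2" "card {y \<in> R. y \<sqsubset> x} \<le> a + 1" "above R \<le> b + 1"
  shows "\<exists>L\<in>linear_extensions_at R r z (Suc a). L x = a + 2"
  using assms
proof (induction "a + b" arbitrary: a b R)
  case 0
  then have ab: "a = 0" "b = 0" by auto
  note R = \<open>good R\<close>
  have fin: "finite R" and z: "z \<in> R" using R finite_good by (auto simp: good_def)
  have ne: "x \<noteq> z" using 0 prec_irrefl by blast
  have card: "card R = 2" using 0 ab by simp
  then have eq: "R = {x, z}" using card_subset_eq[of R "{x, z}"] fin z 0 ne by auto
  have "x \<in> maxs r z R" using 0 ne prec_irrefl prec_asym by (auto simp: maxs_def eq)
  moreover have "linear_extensions_at {z} r z (Suc 0) \<noteq> {}"
    using F_singleton unfolding F_def N_weighted_def by fastforce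
  then obtain L where "L \<in> linear_extensions_at {z} r z (Suc 0)" by blast
  moreover have "R - {x} = {z}" using eq ne by auto
  ultimately have "append_last R x L \<in> linear_extensions_at R r z (Suc 0)"
    using append_last_in[OF fin z] by simp
  moreover have "append_last R x L x = 2" using 0 card by (simp add: append_last_def)
  ultimately show ?case using ab by (auto intro!: bexI[of _ "append_last R x L"])
next
  case (Suc m)
  note R = \<open>good R\<close>
  have fin: "finite R" and z: "z \<in> R" using R finite_good by (auto simp: good_def)
  have ne: "x \<noteq> z" using Suc.prems prec_irrefl by blast
  have zx: "z \<in> {y \<in> R. y \<sqsubset> x}" using z Suc.prems by simp
  show ?case
  proof (cases a)
    case a: (Suc a')
    have "\<exists>p\<in>mins r z R. \<not> z \<sqsubset> p \<and> card {y \<in> R - {p}. y \<sqsubset> x} \<le> a' + 1"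
    proof (cases "{y \<in> R. y \<sqsubset> x} = {z}")
      case True
      have "below R \<le> card {y \<in> R. y \<sqsubset> x}" unfolding below_def
        using fin prec_trans \<open>z \<sqsubset> x\<close> by (intro card_mono) auto
      define S where "S = R - insert z {y \<in> R. z \<sqsubset> y}"
      have "card (insert z {y \<in> R. z \<sqsubset> y}) \<le> b + 2"
        using Suc.prems(7) fin by (simp add: above_def card_insert_if)
      then have "S \<noteq> {}" unfolding S_def
        using card_mono[of "insert z {y \<in> R. z \<sqsubset> y}" R] fin Suc.prems(5) a by auto
      moreover have "finite S" using fin by (simp add: S_def)
      ultimately obtain p where p: "p \<in> S" "\<And>y. y \<in> S \<Longrightarrow> \<not> y \<sqsubset> p"
        using exists_minimal by metis
      have "\<not> y \<sqsubset> p" if "y \<in> R" for y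
      proof
        assume y: "y \<sqsubset> p"
        then have "y \<in> S" using p(1) that prec_trans[of z y p] by (auto simp: S_def)
        with p(2) y show False by blast
      qed
      then have "p \<in> mins r z R" using p(1) by (auto simp: mins_def S_def)
      moreover have "card {y \<in> R - {p}. y \<sqsubset> x} \<le> card {y \<in> R. y \<sqsubset> x}"
        using fin by (intro card_mono) auto
      ultimately show ?thesis using p(1) True by (auto simp: S_def)
    next
      case False
      define S where "S = {y \<in> R. y \<sqsubset> x} - {z}"
      have "S \<noteq> {}" "finite S" using False zx fin by (auto simp: S_def)
      then obtain p where p: "p \<in> S" "\<And>y. y \<in> S \<Longrightarrow> \<not> y \<sqsubset> p"
        using exists_minimal by metis
      \<comment> \<open>The covering hypothesis enters here: a predecessor of \<open>x\<close> above
        \<open>z\<close> could not be placed before \<open>z\<close>.\<close>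
      have zp: "\<not> z \<sqsubset> p" using p(1) Suc.prems(4)[of p] by (auto simp: S_def)
      have "\<not> y \<sqsubset> p" if "y \<in> R" for y
      proof
        assume y: "y \<sqsubset> p"
        then have "y \<in> S" using p(1) that zp prec_trans[of y p x] by (auto simp: S_def)
        with p(2) y show False by blast
      qed
      then have "p \<in> mins r z R" using p(1) by (auto simp: mins_def S_def)
      moreover have "{y \<in> R - {p}. y \<sqsubset> x} = {y \<in> R. y \<sqsubset> x} - {p}" by auto
      then have "card {y \<in> R - {p}. y \<sqsubset> x} \<le> a' + 1"
        using p(1) fin Suc.prems(6) a by (simp add: S_def)
      ultimately show ?thesis using zp by blast
    qed
    then obtain p where p: "p \<in> mins r z R" "\<not> z \<sqsubset> p" "card {y \<in> R - {p}. y \<sqsubset> x} \<le> a' + 1"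
      by blast
    have pR: "p \<in> R" "p \<noteq> z" "p \<noteq> x" using p Suc.prems(3) by (auto simp: mins_def)
    have "above (R - {p}) \<le> b + 1" using above_remove[OF R pR(1)] Suc.prems(7) by simp
    then obtain L where L: "L \<in> linear_extensions_at (R - {p}) r z (Suc a')" "L x = a' + 2"
      using Suc.hyps(1)[of a' b "R - {p}"] Suc.hyps(2) Suc.prems p pR a fin
      by (auto simp: good_remove)
    then have "prepend R p L \<in> linear_extensions_at R r z (Suc (Suc a'))"
      using prepend_in[OF fin z p(1)] by blast
    moreover have "prepend R p L x = a' + 3" using L pR Suc.prems(2) by (simp add: prepend_def)
    ultimately show ?thesis using a by (auto intro!: bexI[of _ "prepend R p L"])
  next
    case a: 0
    then obtain b' where b: "b = Suc b'" using Suc.hyps(2) by (cases b) auto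
    have below_x: "y = z" if "y \<in> R" "y \<sqsubset> x" for y
    proof (rule ccontr)
      assume "y \<noteq> z"
      then have "card {y, z} \<le> card {y \<in> R. y \<sqsubset> x}" using fin that zx by (intro card_mono) auto
      with \<open>y \<noteq> z\<close> Suc.prems(6) a show False by simp
    qed
    have "card {x, z} < card R" using ne Suc.prems(5) b by simp
    then have "R - {x, z} \<noteq> {}" using card_mono[of "{x, z}" R] by auto
    moreover have "finite (R - {x, z})" using fin by simp
    ultimately obtain q where q: "q \<in> R - {x, z}" "\<And>y. y \<in> R - {x, z} \<Longrightarrow> \<not> q \<sqsubset> y"
      using exists_maximal by metis
    have "\<not> q \<sqsubset> x" using below_x q(1) by blast
    moreover have "\<not> q \<sqsubset> z" using prec_trans[of q z x] \<open>z \<sqsubset> x\<close> \<open>\<not> q \<sqsubset> x\<close> by blast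
    ultimately have qm: "q \<in> maxs r z R" using q by (auto simp: maxs_def)
    have good: "good (R - {q})" "card (R - {q}) = a + b' + 2"
      using good_remove[OF R] q(1) fin Suc.prems(5) b by auto
    have "card {y \<in> R - {q}. y \<sqsubset> x} \<le> card {y \<in> R. y \<sqsubset> x}" using fin by (intro card_mono) auto
    moreover have "above (R - {q}) \<le> b' + 1" using below_above_le[OF good(1)] good(2) a by simp
    ultimately obtain L where L: "L \<in> linear_extensions_at (R - {q}) r z (Suc a)" "L x = a + 2"
      using Suc.hyps(1)[OF _ good(1) _ _ _ good(2)] Suc.hyps(2) Suc.prems q(1) b
      by auto
    then have "append_last R q L \<in> linear_extensions_at R r z (Suc a)"
      using append_last_in[OF fin z qm] by blast
    moreover have "append_last R q L x = a + 2" using L q(1) Suc.prems(2) by (auto simp: append_last_def)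
    ultimately show ?thesis by blast
  qed
qed

lemma covering_successor:
  assumes zX: "z \<in> X" and k: "1 \<le> k" "k < card X" and pos: "N_weighted X r \<omega> z k > 0"
    and x: "x \<in> X" "z \<sqsubset> x" "num_below X r x \<le> k"
  shows "\<exists>L\<in>linear_extensions_at X r z k. \<exists>y\<in>X. L y = Suc k \<and> z \<sqsubset> y"
proof -
  have good: "good X" using zX by (simp add: good_def)
  define S where "S = {y \<in> X. z \<sqsubset> y \<and> num_below X r y \<le> k}"
  have "finite S" "S \<noteq> {}" using finite_X x by (auto simp: S_def)
  then obtain y where y: "y \<in> S" "\<And>w. w \<in> S \<Longrightarrow> \<not> w \<sqsubset> y" using exists_minimal by metis
  \<comment> \<open>\<open>num_below\<close> is monotone, so an element strictly between
    \<open>z\<close> and \<open>y\<close> would lie in \<open>S\<close> as well, against the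
    minimality of \<open>y\<close>.\<close>
  have cover: "\<not> (z \<sqsubset> w \<and> w \<sqsubset> y)" if w: "w \<in> X" for w
  proof
    assume *: "z \<sqsubset> w \<and> w \<sqsubset> y"
    then have "num_below X r w \<le> num_below X r y" unfolding num_below_def
      using finite_X prec_trans[of _ w y] by (intro card_mono) auto
    then have "w \<in> S" using * w y(1) by (simp add: S_def)
    with y(2) * show False by blast
  qed
  have "F X (k - 1) > 0" using pos k by (simp add: F_def)
  then have "above X \<le> card X - k" using F_posD(2)[OF good, of "k - 1" "card X - k"] k by simp
  then have "\<exists>L\<in>linear_extensions_at X r z (Suc (k - 1)). L y = (k - 1) + 2"
    using y(1) k by (intro extension_with_successor[OF good _ _ cover, where b = "card X - k - 1"])
      (auto simp: S_def num_below_def)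
  then show ?thesis using y(1) k by (auto simp: S_def)
qed

lemma equality_conditions:
  assumes zX: "z \<in> X" and k: "1 < k" "k < card X" and pos: "N_weighted X r \<omega> z k > 0"
    and eq: "(N_weighted X r \<omega> z k)\<^sup>2 = N_weighted X r \<omega> z (k - 1) * N_weighted X r \<omega> z (k + 1)"
  obtains s where "s > 0"
    "\<And>L x. L \<in> linear_extensions_at X r z k \<Longrightarrow> x \<in> X \<Longrightarrow> L x = k - 1 \<or> L x = k + 1 \<Longrightarrow>
      \<omega> x = s \<and> \<not> x \<sqsubset> z \<and> \<not> z \<sqsubset> x"
proof -
  have good: "good X" using zX by (simp add: good_def)
  \<comment> \<open>\<open>a\<close> and \<open>b\<close> count the elements before and after the
    block formed by \<open>z\<close> and its two neighbours.\<close>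
  define a where "a = k - 2"
  define b where "b = card X - k - 1"
  have ab: "k = Suc (Suc a)" "card X = a + b + 3" using k by (auto simp: a_def b_def)
  obtain s where s: "s > 0" "\<And>u. B X a (side 1 (- s)) u = 0"
    using equality_kernel[OF good, of a] pos eq ab by (auto simp: F_def mult.commute)
  have "\<omega> x = s \<and> \<not> x \<sqsubset> z \<and> \<not> z \<sqsubset> x"
    if "L \<in> linear_extensions_at X r z k" "x \<in> X" "L x = k - 1 \<or> L x = k + 1" for L x
    using kernel_neighbours[OF good ab(2) s, of L x] that ab by (simp add: numeral_3_eq_3)
  with s(1) that show ?thesis by blast
qed

end

theorem theorem1p40:
  fixes X :: "'a set" and r :: "'a rel" and \<omega> :: "'a \<Rightarrow> real" and z :: 'a and n k :: nat
  assumes "finite X" and "card X = n"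
    and "partial_order_on X r"
    and "\<And>x. x \<in> X \<Longrightarrow> \<omega> x > 0"
    and "\<And>x y. x \<in> X \<Longrightarrow> y \<in> X \<Longrightarrow> (x, y) \<in> r \<Longrightarrow> \<omega> x \<ge> \<omega> y"
    and "z \<in> X" and "1 < k" and "k < n"
    and "N_weighted X r \<omega> z k > 0"
  defines "cond_a \<equiv>
      (N_weighted X r \<omega> z k)\<^sup>2 = N_weighted X r \<omega> z (k - 1) * N_weighted X r \<omega> z (k + 1)"
    and "cond_b \<equiv>
      \<exists>s>0. N_weighted X r \<omega> z (k + 1) = s * N_weighted X r \<omega> z k
          \<and> s * N_weighted X r \<omega> z k = s\<^sup>2 * N_weighted X r \<omega> z (k - 1)"
    and "cond_c \<equiv>
      \<exists>s>0. (\<forall>x\<in>X. prec r z x \<longrightarrow> num_below X r x > k)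
          \<and> (\<forall>x\<in>X. prec r x z \<longrightarrow> num_above X r x > n - k + 1)
          \<and> (\<forall>L\<in>linear_extensions_at X r z k.
               \<omega> (inv_into X L (k - 1)) = s \<and> \<omega> (inv_into X L (k + 1)) = s)"
  shows "(cond_a \<longleftrightarrow> cond_b) \<and> (cond_b \<longleftrightarrow> cond_c)"
proof -
  interpret P: weighted_poset X r \<omega> z
    using assms(1,3-5) by unfold_locales
  \<comment> \<open>The reversed order gets a constant weight, since \<open>\<omega>\<close> need
    not be order-reversing for it. Only the existence of extensions is transferred, and that does
    not depend on the weight.\<close>
  interpret D: weighted_poset X "r\<inverse>" "\<lambda>_. 1" z
    using assms(1,3) by unfold_locales simp_all
  let ?N = "N_weighted X r \<omega> z" and ?E = "linear_extensions_at X r z"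
  note fin = assms(1) and zX = assms(6) and pos = assms(9)
  have k: "1 < k" "k < card X" using assms(2,7,8) by auto
  have inv: "inv_into X L (L x) = x" if "L \<in> ?E l" "x \<in> X" for L l x
    using that fin by (intro inv_into_f_f) (auto simp: linear_extensions_at_iff)
  have b_imp_a: cond_a if b: cond_b
  proof -
    obtain s where "s > 0" "?N (k + 1) = s * ?N k" "s * ?N k = s * (s * ?N (k - 1))"
      using b unfolding cond_b_def by (auto simp: power2_eq_square mult.assoc)
    then show ?thesis unfolding cond_a_def by (simp add: power2_eq_square)
  qed
  have a_imp_c: cond_c if a: cond_a
  proof -
    obtain s where s: "s > 0" "\<And>L x. L \<in> ?E k \<Longrightarrow> x \<in> X \<Longrightarrow> L x = k - 1 \<or> L x = k + 1 \<Longrightarrow>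
        \<omega> x = s \<and> \<not> prec r x z \<and> \<not> prec r z x"
      using P.equality_conditions[OF zX k pos] a unfolding cond_a_def by metis
    have up: "num_below X r x > k" if x: "x \<in> X" "prec r z x" for x
    proof (rule ccontr)
      assume "\<not> num_below X r x > k"
      then obtain L y where "L \<in> ?E k" "y \<in> X" "L y = Suc k" "prec r z y"
        using P.covering_successor[OF zX _ k(2) pos x] k by auto
      then show False using s(2)[of L y] by auto
    qed
    have down: "num_above X r x > n - k + 1" if x: "x \<in> X" "prec r x z" for x
    proof (rule ccontr)
      assume "\<not> num_above X r x > n - k + 1"
      \<comment> \<open>In the reversed order \<open>z\<close> has position
        \<open>n + 1 - k\<close>, which is the origin of the constant in the bound on
        \<open>num_above\<close>.\<close>
      then have x': "num_below X (r\<inverse>) x \<le> card X + 1 - k" "prec (r\<inverse>) z x"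
        using x k assms(2) by (auto simp: num_below_def num_above_def prec_converse)
      have "?E k \<noteq> {}" using pos by (auto simp: N_weighted_def)
      then obtain L0 where "L0 \<in> ?E k" by blast
      from reverse_extension[OF fin zX this]
      have "N_weighted X (r\<inverse>) (\<lambda>_. 1) z (card X + 1 - k) > 0"
        by (subst N_weighted_pos_iff[OF fin]) auto
      moreover have "1 \<le> card X + 1 - k" "card X + 1 - k < card X" using k by linarith+
      ultimately obtain L y where L: "L \<in> linear_extensions_at X (r\<inverse>) z (card X + 1 - k)"
        and y: "y \<in> X" "L y = Suc (card X + 1 - k)" "prec (r\<inverse>) z y"
        using D.covering_successor[OF zX _ _ _ x(1) x'(2,1)] by blast
      have "(\<lambda>y\<in>X. card X + 1 - L y) \<in> ?E k"
        using reverse_extension[OF fin zX L] k by simp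
      moreover have "(\<lambda>y\<in>X. card X + 1 - L y) y = k - 1" using y k by simp
      ultimately show False using s(2) y(1,3) by (metis prec_converse)
    qed
    have weights: "\<omega> (inv_into X L (k - 1)) = s \<and> \<omega> (inv_into X L (k + 1)) = s" if L: "L \<in> ?E k" for L
    proof -
      have range: "1 \<le> k - 1" "k - 1 \<le> card X" "1 \<le> k + 1" "k + 1 \<le> card X" using k by linarith+
      obtain x where "x \<in> X" "L x = k - 1" using linear_extensions_at_surj[OF L range(1,2)] .
      moreover obtain y where "y \<in> X" "L y = k + 1" using linear_extensions_at_surj[OF L range(3,4)] .
      ultimately show ?thesis using s(2)[OF L] inv[OF L] by metis
    qed
    show ?thesis unfolding cond_c_def using s(1) up down weights by blast
  qed
  have c_imp_b: cond_b if c: cond_c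
  proof -
    obtain s where s: "s > 0" and up: "\<And>x. x \<in> X \<Longrightarrow> prec r z x \<Longrightarrow> num_below X r x > k"
      and down: "\<And>x. x \<in> X \<Longrightarrow> prec r x z \<Longrightarrow> num_above X r x > n - k + 1"
      and wt: "\<And>L. L \<in> ?E k \<Longrightarrow> \<omega> (inv_into X L (k - 1)) = s \<and> \<omega> (inv_into X L (k + 1)) = s"
      using c unfolding cond_c_def by blast
    \<comment> \<open>An element above \<open>z\<close> has more than \<open>k\<close> predecessors,
      hence position at least \<open>k + 2\<close> in every linear extension, wherever
      \<open>z\<close> stands; dually for elements below. So the swaps are also controlled for
      extensions with \<open>z\<close> at \<open>k - 1\<close> or \<open>k + 1\<close>.\<close>
    have up': "\<not> prec r z x" if "L \<in> ?E l" "x \<in> X" "L x \<le> k + 1" for L l x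
      using num_below_less[OF fin that(1,2)] up[OF that(2)] that(3) by auto
    have down': "\<not> prec r x z" if "L \<in> ?E l" "x \<in> X" "L x \<ge> k - 1" for L l x
      using num_above_le[OF fin that(1,2)] down[OF that(2)] that(3) assms(2) k by auto
    have 1: "?N (Suc k) = s * ?N k"
    proof (rule N_weighted_swap[OF fin zX])
      show "\<omega> x = s" if "L \<in> ?E k" "x \<in> X" "L x = Suc k" for L x
        using wt[OF that(1)] inv[OF that(1,2)] that(3) by simp
    qed (use k up' down' in auto)
    have 2: "?N (Suc (k - 1)) = s * ?N (k - 1)"
    proof (rule N_weighted_swap[OF fin zX])
      fix L x assume L: "L \<in> ?E (k - 1)" "x \<in> X" "L x = Suc (k - 1)"
      let ?L = "swap_adjacent X (k - 1) L"
      \<comment> \<open>The condition on weights concerns only extensions with \<open>z\<close> at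
        \<open>k\<close>. Exchanging \<open>z\<close> with its successor \<open>x\<close> produces
        one, in which \<open>x\<close> sits at \<open>k - 1\<close>.\<close>
      have "?L \<in> ?E k"
      proof (rule swap_adjacent_in[OF fin zX L(1)])
        show "\<not> prec r y w" if "y \<in> X" "w \<in> X" "L y = k - 1" "L w = Suc (k - 1)" for y w
        proof -
          have "L z = k - 1" "inj_on L X" using L(1) fin by (auto simp: linear_extensions_at_iff)
          then have "y = z" using that zX by (metis inj_onD)
          then show ?thesis using up'[OF L(1) that(2)] that(4) k by simp
        qed
      qed (use k in auto)
      moreover have "?L x = k - 1" using L by (simp add: swap_adjacent_def)
      ultimately show "\<omega> x = s" using wt inv[of ?L k x] L(2) by metis
    qed (use k up' down' in auto)
    show ?thesis unfolding cond_b_def using s 1 2 k by (auto simp: power2_eq_square)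
  qed
  show ?thesis using b_imp_a a_imp_c c_imp_b by blast
qed

end
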